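(* Let $D$ be a link diagram, let $\mathbb{T}=\mathbb{T}(D)$ be a Tait graph of $D$, and let $r\ge 1$. Then the signed plane graph $\mathbb{T}_r(D)$, defined by $\mathbb{T}_1(D)=\mathbb{T}$ and $\mathbb{T}_r(D)=\mathbb{T}_{r-1}(D)^*\uplus\mathbb{T}$ for $r\ge 2$, is the Tait graph of the $r$-fold parallel $D_r$ of $D$ (for one of the two checkerboard colourings of $D_r$); that is, $\mathbb{T}_r(D)=\mathbb{T}_1(D_r)=\mathbb{T}(D_r)$.
   Context: Link diagrams $D\subset S^2$ are always assumed connected: every component (region) of $S^2-D$ is a disc. This is also assumed for the parallels of $D$, so $D$ has at least one crossing. A plane graph is a graph cellularly embedded in $S^2$. Two (signed) plane graphs are equal if a homeomorphism of $S^2$ carries one to the other (preserving signs). Tait graph: colour the regions of $D$ black and white so that adjacent regions have different colours (a checkerboard colouring). The Tait graph $\mathbb{T}(D)$ has one vertex in each black region and one edge through each crossing, joining the black regions that meet there. Each edge carries the Tait sign of its crossing: the $A$-splicing of a crossing is the smoothing joining the two local regions swept out when the over-strand is rotated counterclockwise until it reaches the under-strand, and the Tait sign is $+$ if the $A$-splicing merges the two local black regions and $-$ otherwise. $D$ has two Tait graphs, one for each colouring. Duality: $G^*$ is the geometric dual of a plane graph $G$, drawn in standard position (each vertex of $G^*$ in a face of $G$ and vice versa, each edge $e$ of $G$ meeting only $e^*$, in one point). If $e$ has sign $m$ then $e^*$ has sign $-m$. Overlay product: if $G,H$ are drawn on $S^2$ so that the vertices of each lie in faces of the other, $G\uplus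 H$ is the union of the two drawings with a new vertex added wherever an edge of $G$ meets an edge of $H$; each edge of $G\uplus H$ inherits the sign of the edge of $G$ or $H$ that contains it. In the recursion $\mathbb{T}_r=\mathbb{T}_{r-1}^*\uplus\mathbb{T}$: by construction $\mathbb{T}_{r-1}$ contains the drawing of $\mathbb{T}$ (each edge of $\mathbb{T}$ subdivided into edges of $\mathbb{T}_{r-1}$, each vertex of $\mathbb{T}$ being a vertex of $\mathbb{T}_{r-1}$). The dual $\mathbb{T}_{r-1}^*$ is drawn in standard position relative to $\mathbb{T}_{r-1}$, hence the vertices of $\mathbb{T}$ lie in faces of $\mathbb{T}_{r-1}^*$, and the overlay is taken with this drawing of $\mathbb{T}$. The $r$-fold parallel $D_r$ is the diagram in which each link component of $D$ is replaced by $r$ copies, all parallel in the plane, each copy repeating the over- and under-crossing behaviour of $D$ (so each crossing of $D$ becomes an $r\times r$ grid of $r^2$ crossings). *)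

theory Defs
  imports "HOL-Combinatorics.Orbits"
begin

section \<open>Plane graphs\<close>

text \<open>
  A graph cellularly embedded in the oriented sphere is recorded as a combinatorial map.  A dart is
  an edge together with a direction; it starts at its tail.  \<open>opp\<close> reverses a dart, and \<open>nxt\<close>
  sends a dart to the next one, counterclockwise, around its tail.  Vertices and edges are the
  orbits of \<open>nxt\<close> and \<open>opp\<close>.  A dart \<open>d\<close> and \<open>nxt d\<close> span a corner of the region to the left
  of \<open>d\<close>, and \<open>opp (nxt d)\<close> has this same region on its left, so regions are the orbits of
  \<open>opp \<circ> nxt\<close>.
\<close>

record 'd pmap =
  darts :: "'d set"
  opp :: "'d \<Rightarrow> 'd"
  nxt :: "'d \<Rightarrow> 'd"

definition verts :: "('d, 'z) pmap_scheme \<Rightarrow> 'd set set" where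
  "verts M = orbit (nxt M) ` darts M"

definition edges :: "('d, 'z) pmap_scheme \<Rightarrow> 'd set set" where
  "edges M = orbit (opp M) ` darts M"

definition face :: "('d, 'z) pmap_scheme \<Rightarrow> 'd \<Rightarrow> 'd set" where
  "face M d = orbit (opp M \<circ> nxt M) d"

definition faces :: "('d, 'z) pmap_scheme \<Rightarrow> 'd set set" where
  "faces M = face M ` darts M"

definition prv :: "('d, 'z) pmap_scheme \<Rightarrow> 'd \<Rightarrow> 'd" where
  "prv M = inv_into (darts M) (nxt M)"

definition connected_map :: "('d, 'z) pmap_scheme \<Rightarrow> bool" where
  "connected_map M \<longleftrightarrow>
     (\<forall>d\<in>darts M. \<forall>e\<in>darts M. (d, e) \<in> {(x, y). x \<in> darts M \<and> (y = opp M x \<or> y = nxt M x)}\<^sup>*)"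

text \<open>The last conjunct is Euler's formula: the surface obtained by gluing a disc into every
  region is the sphere.  (The graph with one vertex and no edge is not represented.)\<close>

definition plane_graph :: "('d, 'z) pmap_scheme \<Rightarrow> bool" where
  "plane_graph M \<longleftrightarrow>
     finite (darts M) \<and> darts M \<noteq> {} \<and>
     (\<forall>d\<in>darts M. opp M d \<in> darts M \<and> opp M d \<noteq> d \<and> opp M (opp M d) = d) \<and>
     bij_betw (nxt M) (darts M) (darts M) \<and>
     connected_map M \<and>
     card (verts M) + card (faces M) = card (edges M) + 2"

record 'd sgraph = "'d pmap" +
  pos :: "'d \<Rightarrow> bool"

definition signed_plane_graph :: "'d sgraph \<Rightarrow> bool" where
  "signed_plane_graph G \<longleftrightarrow> plane_graph G \<and> (\<forall>d\<in>darts G. pos G (opp G d) = pos G d)"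

text \<open>Equality up to a homeomorphism of the sphere, which may preserve (first disjunct) or reverse
  (second disjunct) the orientation.\<close>

definition plane_eq :: "'d sgraph \<Rightarrow> 'e sgraph \<Rightarrow> bool" (infix "\<simeq>" 50) where
  "G \<simeq> H \<longleftrightarrow>
     (\<exists>f. bij_betw f (darts G) (darts H) \<and>
          (\<forall>d\<in>darts G. f (opp G d) = opp H (f d)) \<and>
          (\<forall>d\<in>darts G. pos H (f d) = pos G d) \<and>
          ((\<forall>d\<in>darts G. f (nxt G d) = nxt H (f d)) \<or>
           (\<forall>d\<in>darts G. f (nxt G d) = prv H (f d))))"

definition relabel :: "('d \<Rightarrow> 'e) \<Rightarrow> 'd sgraph \<Rightarrow> 'e sgraph" where
  "relabel f G =
     (let g = inv_into (darts G) f in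
      \<lparr>darts = f ` darts G, opp = (\<lambda>x. f (opp G (g x))), nxt = (\<lambda>x. f (nxt G (g x))),
       pos = (\<lambda>x. pos G (g x))\<rparr>)"


section \<open>Duals and overlays\<close>

text \<open>
  The dart \<open>d\<close> of the dual stands for the dual edge directed so that it crosses \<open>d\<close> from left to
  right; it starts in the region to the left of \<open>d\<close>.  The next edge counterclockwise on the
  boundary of that region is \<open>prv (opp d)\<close>.
\<close>

definition dual :: "'d sgraph \<Rightarrow> 'd sgraph" where
  "dual G = \<lparr>darts = darts G, opp = opp G, nxt = (\<lambda>d. prv G (opp G d)), pos = (\<lambda>d. \<not> pos G d)\<rparr>"

text \<open>
  A pair of drawings \<open>G\<close>, \<open>H\<close> on the sphere, with the vertices of each in faces of the other and
  edges crossing transversally, is recorded by two functions \<open>X\<close> and \<open>Y\<close>.  The list \<open>X g\<close> has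
  one entry for each point, in order, where the dart \<open>g\<close> of \<open>G\<close> meets \<open>H\<close>; the entry is \<open>(h, j)\<close>
  if the point is number \<open>j\<close> (from 0) on the dart \<open>h\<close> of \<open>H\<close>, where \<open>h\<close> is directed so
  as to cross \<open>g\<close> from right to left.  The list \<open>Y h\<close> is the same with \<open>G\<close> and \<open>H\<close> exchanged.

  The dart \<open>(Inl g, i)\<close> of the overlay is the piece number \<open>i\<close> of \<open>g\<close>, with the direction of \<open>g\<close>;
  it starts at the tail of \<open>g\<close> if \<open>i = 0\<close>, and at the point number \<open>i - 1\<close> on \<open>g\<close> otherwise.
  Counterclockwise next to it at that point is the piece leaving it along \<open>h\<close>.
\<close>

definition overlay ::
  "'g sgraph \<Rightarrow> 'h sgraph \<Rightarrow> ('g \<Rightarrow> ('h \<times> nat) list) \<Rightarrow> ('h \<Rightarrow> ('g \<times> nat) list) \<Rightarrow>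
   (('g + 'h) \<times> nat) sgraph" where
  "overlay G H X Y =
     \<lparr>darts = {(Inl g, i) | g i. g \<in> darts G \<and> i \<le> length (X g)} \<union>
              {(Inr h, j) | h j. h \<in> darts H \<and> j \<le> length (Y h)},
      opp = (\<lambda>(s, i). case s of
               Inl g \<Rightarrow> (Inl (opp G g), length (X g) - i)
             | Inr h \<Rightarrow> (Inr (opp H h), length (Y h) - i)),
      nxt = (\<lambda>(s, i). case s of
               Inl g \<Rightarrow> (case i of 0 \<Rightarrow> (Inl (nxt G g), 0)
                                 | Suc k \<Rightarrow> (let (h, j) = X g ! k in (Inr h, Suc j)))
             | Inr h \<Rightarrow> (case i of 0 \<Rightarrow> (Inr (nxt H h), 0)
                                 | Suc k \<Rightarrow> (let (g, j) = Y h ! k in (Inl g, Suc j)))),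
      pos = (\<lambda>(s, i). case s of Inl g \<Rightarrow> pos G g | Inr h \<Rightarrow> pos H h)\<rparr>"

text \<open>
  A drawing of \<open>T\<close> inside \<open>M\<close>, in which each edge of \<open>T\<close> is subdivided into edges of \<open>M\<close>, is
  given by the map \<open>p\<close> sending a dart of \<open>T\<close> to the list of darts of \<open>M\<close> that it traverses.
  When \<open>dual M\<close> is in standard position, the point number \<open>i\<close> on the dart \<open>t\<close> of \<open>T\<close> is where
  \<open>d = p t ! i\<close> meets its dual edge.  The dual dart \<open>d\<close> crosses \<open>d\<close> from left to right,
  hence is itself crossed by \<open>t\<close> from right to left; and \<open>opp M d\<close> in the dual crosses \<open>t\<close>
  from right to left.
\<close>

definition dual_points :: "'t sgraph \<Rightarrow> ('t \<Rightarrow> 'm list) \<Rightarrow> 'm \<Rightarrow> ('t \<times> nat) list" where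
  "dual_points T p d =
     (if \<exists>t\<in>darts T. d \<in> set (p t)
      then [THE (t, i). t \<in> darts T \<and> i < length (p t) \<and> p t ! i = d]
      else [])"

definition path_points :: "'m sgraph \<Rightarrow> ('t \<Rightarrow> 'm list) \<Rightarrow> 't \<Rightarrow> ('m \<times> nat) list" where
  "path_points M p t = map (\<lambda>d. (opp M d, 0)) (p t)"

definition overlay_dual :: "'m sgraph \<Rightarrow> 't sgraph \<Rightarrow> ('t \<Rightarrow> 'm list) \<Rightarrow> (('m + 't) \<times> nat) sgraph" where
  "overlay_dual M T p = overlay (dual M) T (dual_points T p) (path_points M p)"

text \<open>A dart type closed under overlays, so that the recursion below stays within one type.\<close>

datatype 't odart = Dart 't | Piece "'t odart + 't" nat

text \<open>The second component of \<open>tait_rec T r\<close> is the drawing of \<open>T\<close> inside the first one.\<close>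

fun tait_rec :: "'t sgraph \<Rightarrow> nat \<Rightarrow> 't odart sgraph \<times> ('t \<Rightarrow> 't odart list)" where
  "tait_rec T (Suc 0) = (relabel Dart T, \<lambda>t. [Dart t])"
| "tait_rec T (Suc (Suc r)) =
     (let (M, p) = tait_rec T (Suc r) in
      (relabel (case_prod Piece) (overlay_dual M T p),
       \<lambda>t. map (Piece (Inr t)) [0..<Suc (length (p t))]))"

definition tait_iter :: "nat \<Rightarrow> 't sgraph \<Rightarrow> 't odart sgraph" where
  "tait_iter r T = fst (tait_rec T r)"


section \<open>Link diagrams, Tait graphs and parallels\<close>

text \<open>The vertices of the underlying 4-regular plane graph are the crossings; a dart \<open>d\<close> with
  \<open>over d\<close> leaves its crossing along the over-strand.\<close>

record 'd diagram = "'d pmap" +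
  over :: "'d \<Rightarrow> bool"

definition link_diagram :: "'d diagram \<Rightarrow> bool" where
  "link_diagram D \<longleftrightarrow>
     plane_graph D \<and>
     (\<forall>d\<in>darts D. card (orbit (nxt D) d) = 4 \<and> over D (nxt D d) = (\<not> over D d))"

text \<open>\<open>B\<close> is the set of black regions.\<close>

definition checkerboard :: "'d diagram \<Rightarrow> 'd set set \<Rightarrow> bool" where
  "checkerboard D B \<longleftrightarrow>
     B \<subseteq> faces D \<and> (\<forall>d\<in>darts D. face D (opp D d) \<in> B \<longleftrightarrow> face D d \<notin> B)"

text \<open>
  A dart of the Tait graph leaves a black region towards one of its corners, and is named by the
  dart \<open>d\<close> of \<open>D\<close> such that \<open>d\<close> and \<open>nxt d\<close> span this corner.  It arrives through the opposite
  corner of the same crossing.  The next corner counterclockwise along the region is the one at the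
  head of \<open>d\<close>.  The corner of \<open>d\<close> is swept out by rotating \<open>d\<close> counterclockwise; so the
  \<open>A\<close>-splicing merges the black regions iff \<open>d\<close> is on the over-strand.
\<close>

definition tait_graph :: "'d diagram \<Rightarrow> 'd set set \<Rightarrow> 'd sgraph" where
  "tait_graph D B =
     \<lparr>darts = {d \<in> darts D. face D d \<in> B},
      opp = (\<lambda>d. nxt D (nxt D d)),
      nxt = (\<lambda>d. prv D (opp D d)),
      pos = over D\<rparr>"

text \<open>
  Each crossing becomes a grid.  Facing along the dart \<open>d\<close> of \<open>D\<close>, number the \<open>r\<close> copies of its
  strand \<open>i = 0, \<dots>, r - 1\<close> from left to right, and the copies of the transverse strand
  \<open>j = 0, \<dots>, r - 1\<close> from the far end backwards.  Then \<open>(d, i, j)\<close> is the dart with the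
  direction of \<open>d\<close> leaving the grid point \<open>(i, j)\<close>.  For \<open>j = 0\<close> it leaves the grid and runs
  parallel to \<open>d\<close> to the grid at the other end; for \<open>j > 0\<close> it ends at \<open>(i, j - 1)\<close>, where its
  reverse has the direction of \<open>nxt D (nxt D d)\<close>, seen from which both numberings are reversed.
\<close>

definition parallel :: "nat \<Rightarrow> 'd diagram \<Rightarrow> ('d \<times> nat \<times> nat) diagram" where
  "parallel r D =
     \<lparr>darts = darts D \<times> {..<r} \<times> {..<r},
      opp = (\<lambda>(d, i, j). if j = 0 then (opp D d, r - 1 - i, 0)
                         else (nxt D (nxt D d), r - 1 - i, r - j)),
      nxt = (\<lambda>(d, i, j). (nxt D d, r - 1 - j, i)),
      over = (\<lambda>(d, i, j). over D d)\<rparr>"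

end

theory Submission
  imports Defs
begin

text \<open>
  In the parallel \<open>D\<^sub>r\<close> each crossing of \<open>D\<close> has become a grid of size \<open>r\<close>.  The edge of the Tait
  graph \<open>T\<close> of \<open>D\<close> through this crossing joins two opposite black corners, so it can be drawn along a
  diagonal of the grid, where it passes through \<open>r\<close> crossings of \<open>D\<^sub>r\<close>.  Cut the grid of size
  \<open>r - 1\<close> open along its diagonal, double the crossings on the cut, and insert a new diagonal of \<open>r\<close>
  crossings between the two halves: the result is the grid of size \<open>r\<close>.  This is what the recursion
  does.  The dual of the Tait graph of \<open>D\<^sub>r\<^sub>-\<^sub>1\<close> is the other Tait graph of
  \<open>D\<^sub>r\<^sub>-\<^sub>1\<close>, with one edge through each crossing.  Laying \<open>T\<close> over it cuts every dual edge on the diagonal into two, and divides the edge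
  of \<open>T\<close> itself into \<open>r\<close> pieces, one for each crossing on the new diagonal.

  In coordinates this is the map \<open>insert_diagonal\<close>, and \<open>map_iso_insert_diagonal\<close> says that it is an
  isomorphism from the overlay to the Tait graph of the next parallel.  The theorem follows by
  induction (\<open>tait_rec_parallel\<close>), where each step first replaces the graph obtained so far by an
  isomorphic one, keeping track of the drawing of \<open>T\<close> inside it (\<open>map_iso_overlay_dual\<close>).

  Planarity is not followed through overlays.  It is shown for diagrams and transported along the
  isomorphisms: a parallel of a diagram is a diagram, by counting its regions
  (\<open>link_diagram_parallel\<close>), and the Tait graph of any diagram is a signed plane graph
  (\<open>signed_plane_graph_tait\<close>).
\<close>


section \<open>Orbits of a permutation of a finite set\<close>

lemma self_in_orbit_bij:
  assumes "finite S" "bij_betw f S S" "x \<in> S"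
  shows "x \<in> orbit f x"
proof -
  have "perm_restrict f S permutes S"
    using assms(2) by (intro bij_imp_permutes) (auto simp: perm_restrict_def cong: bij_betw_cong)
  then have "x \<in> orbit (perm_restrict f S) x"
    using assms(1) by (intro permutation_self_in_orbit) (auto simp: permutation_permutes)
  also have "orbit (perm_restrict f S) x = orbit f x"
    using assms(2,3)
    by (intro orbit_cong0[of _ S]) (auto simp: perm_restrict_def bij_betw_def)
  finally show ?thesis .
qed

lemma orbit_closed:
  assumes "y \<in> orbit f x" "x \<in> S" "\<And>z. z \<in> S \<Longrightarrow> f z \<in> S"
  shows "y \<in> S"
  using assms(1) by induct (auto intro: assms)

lemma orbit_subset_bij:
  assumes "bij_betw f S S" "x \<in> S"
  shows "orbit f x \<subseteq> S"
  using assms orbit_closed[of _ f x S] bij_betwE[OF assms(1)] by blast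

lemma orbit_eq_bij:
  assumes "finite S" "bij_betw f S S" "x \<in> S" "y \<in> orbit f x"
  shows "orbit f y = orbit f x"
proof -
  have "x \<in> orbit f x"
    using assms by (intro self_in_orbit_bij)
  then have "x \<in> orbit f y"
    using assms(4) by (rule orbit_swap)
  then show ?thesis
    using assms(4) by (auto intro: orbit_trans)
qed

lemma card_orbits:
  assumes "finite S" "bij_betw f S S" "\<And>x. x \<in> S \<Longrightarrow> card (orbit f x) = k"
  shows "k * card (orbit f ` S) = card S"
proof -
  have sub: "orbit f x \<subseteq> S" if "x \<in> S" for x
    using that assms(2) by (rule orbit_subset_bij[rotated])
  have U: "\<Union> (orbit f ` S) = S"
    using sub self_in_orbit_bij[OF assms(1,2)] by blast
  have disj: "c1 \<inter> c2 = {}" if "c1 \<in> orbit f ` S" "c2 \<in> orbit f ` S" "c1 \<noteq> c2" for c1 c2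
    using that orbit_eq_bij[OF assms(1,2)] by blast
  show ?thesis
    using card_partition[of "orbit f ` S" k] assms(1,3) disj by (auto simp: U)
qed

lemma orbit_image_conj:
  assumes "finite S" "bij_betw f S S" "x \<in> S" "\<And>z. z \<in> S \<Longrightarrow> g (h z) = h (f z)"
  shows "orbit g (h x) = h ` orbit f x"
  using orbit_inverse[of x f g h, OF self_in_orbit_bij[OF assms(1-3)]] assms(2-4)
  by (metis bij_betwE orbit_closed)

lemma orbit_left_inverse_subset:
  assumes "finite S" "bij_betw f S S" "x \<in> S" "\<And>z. z \<in> S \<Longrightarrow> g (f z) = z"
  shows "orbit g x \<subseteq> orbit f x"
proof
  have *: "g y \<in> orbit f x" if "y \<in> orbit f x" for y
    using that
  proof cases
    case base
    then show ?thesis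
      using assms self_in_orbit_bij by metis
  next
    case (step z)
    then show ?thesis
      using assms(2-4) by (metis bij_betwE orbit_closed)
  qed
  fix y
  assume "y \<in> orbit g x"
  then show "y \<in> orbit f x"
    using self_in_orbit_bij[OF assms(1-3)] * by (induct) auto
qed

text \<open>
  Tait graphs go around a region of the diagram against the direction of \<open>opp \<circ> nxt\<close>; this lemma
  turns their vertices into regions.
\<close>

lemma orbit_inverse_eq:
  assumes "finite S" "bij_betw f S S" "x \<in> S"
    and "\<And>z. z \<in> S \<Longrightarrow> g z \<in> S" "\<And>z. z \<in> S \<Longrightarrow> g (f z) = z" "\<And>z. z \<in> S \<Longrightarrow> f (g z) = z"
  shows "orbit g x = orbit f x"
proof -
  have "bij_betw g S S"
    using assms(2,4-6) by (intro bij_betw_byWitness[of S f]) (auto dest: bij_betwE)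
  then show ?thesis
    using orbit_left_inverse_subset[of S f x g] orbit_left_inverse_subset[of S g x f] assms by blast
qed

lemma card_orbit_involution:
  assumes "f (f x) = x" "f x \<noteq> x"
  shows "card (orbit f x) = 2"
proof -
  have "orbit f x = {(f ^^ m) x | m. m < 2}"
    using assms by (intro orbit_altdef_bounded) (auto simp: numeral_2_eq_2)
  also have "\<dots> = {x, f x}"
    by (auto simp: less_Suc_eq numeral_2_eq_2 intro: exI[of _ 0] exI[of _ "Suc 0"])
  finally show ?thesis
    using assms(2) by simp
qed

text \<open>
  A point fixed by \<open>f ^^ 4\<close> but not by \<open>f ^^ 2\<close> already lies on a 4-cycle, so that only one
  inequality has to be checked for each grid point and each quadrilateral region.
\<close>

lemma card_orbit_4I:
  assumes "f (f (f (f x))) = x" "f (f x) \<noteq> x"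
  shows "card (orbit f x) = 4"
proof -
  have "orbit f x = {(f ^^ m) x | m. m < 4}"
    using assms by (intro orbit_altdef_bounded) (auto simp: eval_nat_numeral)
  also have "\<dots> = {x, f x, f (f x), f (f (f x))}"
    by (auto simp: less_Suc_eq eval_nat_numeral intro: exI[of _ 0] exI[of _ "Suc 0"]
        exI[of _ "Suc (Suc 0)"] exI[of _ "Suc (Suc (Suc 0))"])
  finally show ?thesis
    using assms by (auto simp: card_insert_if)
qed

lemma card_orbit_4D:
  assumes "x \<in> orbit f x" "card (orbit f x) = 4"
  shows "f (f (f (f x))) = x" "f (f x) \<noteq> x"
proof -
  have 4: "funpow_dist1 f x x = 4"
    using assms(2) inj_on_funpow_dist1[OF assms(1)]
    by (subst (asm) orbit_conv_funpow_dist1[OF assms(1)]) (simp add: card_image)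
  show "f (f (f (f x))) = x"
    using funpow_dist1_prop[OF assms(1)] unfolding 4 by (simp add: eval_nat_numeral)
  show "f (f x) \<noteq> x"
    using funpow_neq_less_funpow_dist1[OF assms(1), of 2 0] unfolding 4
    by (simp add: eval_nat_numeral)
qed


section \<open>Combinatorial maps\<close>

text \<open>
  Connectedness is used throughout in this form: a nonempty set of darts closed under \<open>opp\<close> and
  \<open>nxt\<close> contains every dart.  Paths never have to be constructed or reversed.
\<close>

lemma connected_mapI:
  assumes "\<And>d. d \<in> darts M \<Longrightarrow> opp M d \<in> darts M" "\<And>d. d \<in> darts M \<Longrightarrow> nxt M d \<in> darts M"
    and "\<And>S. S \<subseteq> darts M \<Longrightarrow> S \<noteq> {} \<Longrightarrow> (\<And>d. d \<in> S \<Longrightarrow> opp M d \<in> S) \<Longrightarrow>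
      (\<And>d. d \<in> S \<Longrightarrow> nxt M d \<in> S) \<Longrightarrow> S = darts M"
  shows "connected_map M"
proof -
  let ?R = "{(x, y). x \<in> darts M \<and> (y = opp M x \<or> y = nxt M x)}"
  have "?R\<^sup>* `` {d} = darts M" if "d \<in> darts M" for d
  proof (rule assms(3))
    show sub: "?R\<^sup>* `` {d} \<subseteq> darts M"
    proof
      fix e
      assume "e \<in> ?R\<^sup>* `` {d}"
      then have "(d, e) \<in> ?R\<^sup>*"
        by simp
      then show "e \<in> darts M"
        by induct (use that assms(1,2) in auto)
    qed
    show "opp M e \<in> ?R\<^sup>* `` {d}" "nxt M e \<in> ?R\<^sup>* `` {d}" if "e \<in> ?R\<^sup>* `` {d}" for e
      using that sub by (auto intro: rtrancl_into_rtrancl)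
  qed auto
  then show ?thesis
    unfolding connected_map_def by blast
qed

lemma connected_map_closed:
  assumes "connected_map M" "S \<subseteq> darts M" "S \<noteq> {}"
    and "\<And>d. d \<in> S \<Longrightarrow> opp M d \<in> S" "\<And>d. d \<in> S \<Longrightarrow> nxt M d \<in> S"
  shows "S = darts M"
proof -
  let ?R = "{(x, y). x \<in> darts M \<and> (y = opp M x \<or> y = nxt M x)}"
  obtain d where d: "d \<in> S"
    using assms(3) by blast
  have "e \<in> S" if "e \<in> darts M" for e
  proof -
    have "(d, e) \<in> ?R\<^sup>*"
      using assms(1,2) d that unfolding connected_map_def by blast
    then show ?thesis
      by induct (use d assms(4,5) in auto)
  qed
  then show ?thesis
    using assms(2) by blast
qed

lemma prv_eqI:
  assumes "inj_on (nxt M) (darts M)" "d \<in> darts M" "nxt M d = e"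
  shows "prv M e = d"
  using assms by (auto simp: prv_def)

lemma plane_graphD:
  assumes "plane_graph M"
  shows "finite (darts M)" "darts M \<noteq> {}" "bij_betw (nxt M) (darts M) (darts M)"
    "inj_on (nxt M) (darts M)" "connected_map M"
    "card (verts M) + card (faces M) = card (edges M) + 2"
    and "\<And>d. d \<in> darts M \<Longrightarrow> opp M d \<in> darts M"
    and "\<And>d. d \<in> darts M \<Longrightarrow> opp M d \<noteq> d"
    and "\<And>d. d \<in> darts M \<Longrightarrow> opp M (opp M d) = d"
    and "\<And>d. d \<in> darts M \<Longrightarrow> nxt M d \<in> darts M"
  using assms by (auto simp: plane_graph_def bij_betw_def)

lemma bij_face_step:
  assumes "plane_graph M"
  shows "bij_betw (opp M \<circ> nxt M) (darts M) (darts M)"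
proof (rule bij_betw_trans)
  show "bij_betw (opp M) (darts M) (darts M)"
    using plane_graphD[OF assms] by (intro bij_betw_byWitness[of _ "opp M"]) auto
qed (rule plane_graphD[OF assms])

lemma card_edges:
  assumes "finite (darts M)"
    and "\<forall>d\<in>darts M. opp M d \<in> darts M \<and> opp M d \<noteq> d \<and> opp M (opp M d) = d"
  shows "2 * card (edges M) = card (darts M)"
proof -
  have "bij_betw (opp M) (darts M) (darts M)"
    using assms by (intro bij_betw_byWitness[of _ "opp M"]) auto
  then show ?thesis
    using assms unfolding edges_def by (intro card_orbits) (auto intro: card_orbit_involution)
qed


section \<open>Isomorphisms of signed plane graphs\<close>

text \<open>
  Orientation preserving isomorphism.  Closure of \<open>darts G\<close> is included because \<open>f\<close> may
  also send darts outside \<open>darts G\<close> into \<open>darts H\<close>, so that it could hide a violation; with it,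
  isomorphisms can be inverted and planarity can be pulled back to an overlay about which nothing
  else is known.
\<close>

definition map_iso :: "('d \<Rightarrow> 'e) \<Rightarrow> 'd sgraph \<Rightarrow> 'e sgraph \<Rightarrow> bool" where
  "map_iso f G H \<longleftrightarrow>
     bij_betw f (darts G) (darts H) \<and>
     (\<forall>d\<in>darts G. opp G d \<in> darts G \<and> nxt G d \<in> darts G \<and>
        f (opp G d) = opp H (f d) \<and> f (nxt G d) = nxt H (f d) \<and> pos H (f d) = pos G d)"

lemma map_iso_plane_eq: "map_iso f G H \<Longrightarrow> G \<simeq> H"
  unfolding map_iso_def plane_eq_def by blast

lemma map_iso_comp:
  assumes "map_iso f G H" "map_iso g H K"
  shows "map_iso (g \<circ> f) G K"
  using assms unfolding map_iso_def
  by (auto intro: bij_betw_trans dest: bij_betwE)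

lemma map_iso_sym:
  assumes "map_iso f G H"
  shows "map_iso (inv_into (darts G) f) H G"
proof -
  have f: "bij_betw f (darts G) (darts H)"
    using assms by (simp add: map_iso_def)
  have *: "\<exists>d\<in>darts G. y = f d" if "y \<in> darts H" for y
    using f that by (auto simp: bij_betw_def)
  have inv: "inv_into (darts G) f (f d) = d" if "d \<in> darts G" for d
    using f that by (auto simp: bij_betw_def)
  have "\<forall>y\<in>darts H. opp H y \<in> darts H \<and> nxt H y \<in> darts H \<and>
      inv_into (darts G) f (opp H y) = opp G (inv_into (darts G) f y) \<and>
      inv_into (darts G) f (nxt H y) = nxt G (inv_into (darts G) f y) \<and>
      pos G (inv_into (darts G) f y) = pos H y"
  proof
    fix y
    assume "y \<in> darts H"
    then obtain d where d: "d \<in> darts G" "y = f d"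
      using * by blast
    have "opp G d \<in> darts G" "nxt G d \<in> darts G" "opp H y = f (opp G d)" "nxt H y = f (nxt G d)"
      "pos H y = pos G d"
      using assms d by (auto simp: map_iso_def)
    then show "opp H y \<in> darts H \<and> nxt H y \<in> darts H \<and>
      inv_into (darts G) f (opp H y) = opp G (inv_into (darts G) f y) \<and>
      inv_into (darts G) f (nxt H y) = nxt G (inv_into (darts G) f y) \<and>
      pos G (inv_into (darts G) f y) = pos H y"
      using d inv bij_betwE[OF f] by simp
  qed
  then show ?thesis
    using f unfolding map_iso_def by (auto intro: bij_betw_inv_into)
qed

lemma map_iso_relabel:
  assumes "inj_on f (darts G)"
    and "\<And>d. d \<in> darts G \<Longrightarrow> opp G d \<in> darts G" "\<And>d. d \<in> darts G \<Longrightarrow> nxt G d \<in> darts G"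
  shows "map_iso f G (relabel f G)"
  using assms by (auto simp: map_iso_def relabel_def Let_def bij_betw_def)

lemma card_orbits_iso:
  assumes "finite S" "bij_betw g S S" "inj_on f S" "\<And>d. d \<in> S \<Longrightarrow> h (f d) = f (g d)"
  shows "card (orbit h ` f ` S) = card (orbit g ` S)"
proof -
  have "orbit h ` f ` S = (\<lambda>X. f ` X) ` orbit g ` S"
    using orbit_image_conj[OF assms(1,2), of _ h f] assms(4) by (auto simp: image_iff)
  moreover have "inj_on (\<lambda>X. f ` X) (orbit g ` S)"
  proof (rule inj_on_subset[OF inj_on_image_Pow[OF assms(3)]])
    show "orbit g ` S \<subseteq> Pow S"
      using orbit_subset_bij[OF assms(2)] by auto
  qed
  ultimately show ?thesis
    by (simp add: card_image)
qed

lemma signed_plane_graph_iso: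
  assumes "map_iso f G H" "signed_plane_graph G"
  shows "signed_plane_graph H"
proof -
  have pl: "plane_graph G"
    using assms(2) by (simp add: signed_plane_graph_def)
  note G = plane_graphD[OF pl]
  have f: "f ` darts G = darts H" "inj_on f (darts G)"
    and iso: "\<And>d. d \<in> darts G \<Longrightarrow> opp H (f d) = f (opp G d)"
      "\<And>d. d \<in> darts G \<Longrightarrow> nxt H (f d) = f (nxt G d)"
      "\<And>d. d \<in> darts G \<Longrightarrow> pos H (f d) = pos G d"
    using assms(1) by (auto simp: map_iso_def bij_betw_def)
  have eq: "f d = f e \<longleftrightarrow> d = e" if "d \<in> darts G" "e \<in> darts G" for d e
    using f(2) that by (auto dest: inj_onD)
  have opp: "\<forall>d\<in>darts H. opp H d \<in> darts H \<and> opp H d \<noteq> d \<and> opp H (opp H d) = d"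
    using G(7-9) by (auto simp: f(1)[symmetric] iso eq)
  have "bij_betw (nxt H) (darts H) (darts H)"
    unfolding bij_betw_def
  proof
    show "inj_on (nxt H) (darts H)"
      using G(4,10) by (auto simp: f(1)[symmetric] iso inj_on_def eq)
    have "nxt H ` f ` darts G = f ` nxt G ` darts G"
      using iso by (auto simp: image_iff)
    then show "nxt H ` darts H = darts H"
      using G(3) f by (simp add: bij_betw_def)
  qed
  moreover have "connected_map H"
  proof (rule connected_mapI)
    fix S
    assume S: "S \<subseteq> darts H" "S \<noteq> {}" "\<And>d. d \<in> S \<Longrightarrow> opp H d \<in> S" "\<And>d. d \<in> S \<Longrightarrow> nxt H d \<in> S"
    obtain e where e: "e \<in> S" "e \<in> f ` darts G"
      using S(1,2) unfolding f(1) by (meson all_not_in_conv subsetD)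
    have "{d \<in> darts G. f d \<in> S} = darts G"
    proof (rule connected_map_closed[OF G(5), rotated])
      fix d
      assume "d \<in> {d \<in> darts G. f d \<in> S}"
      then show "opp G d \<in> {d \<in> darts G. f d \<in> S}" "nxt G d \<in> {d \<in> darts G. f d \<in> S}"
        using S(3,4)[of "f d"] G(7,10) iso(1,2) by simp_all
    next
      show "{d \<in> darts G. f d \<in> S} \<noteq> {}"
        using e by blast
    qed simp
    then have "darts H \<subseteq> S"
      unfolding f(1)[symmetric] by (auto simp: set_eq_iff)
    then show "S = darts H"
      using S(1) by simp
  qed (use opp G(10) in \<open>auto simp: f(1)[symmetric] iso\<close>)
  moreover have "card (verts H) = card (verts G)"
    unfolding verts_def f(1)[symmetric] using G f iso by (intro card_orbits_iso) auto
  moreover have "card (edges H) = card (edges G)"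
  proof -
    have "finite (darts H)"
      using G(1) f(1) by (metis finite_imageI)
    then have "2 * card (edges H) = card (darts H)"
      using opp by (rule card_edges)
    moreover have "2 * card (edges G) = card (darts G)"
      using G by (intro card_edges) auto
    moreover have "card (darts H) = card (darts G)"
      using card_image[OF f(2)] f(1) by simp
    ultimately show ?thesis
      by simp
  qed
  moreover have "card (faces H) = card (faces G)"
    unfolding faces_def face_def f(1)[symmetric] using G f iso bij_face_step[OF pl]
    by (intro card_orbits_iso) auto
  ultimately have "plane_graph H"
    using G(1,2,6) opp unfolding plane_graph_def by (simp flip: f(1))
  moreover have "\<forall>d\<in>darts H. pos H (opp H d) = pos H d"
    using assms(2) G(7) by (auto simp: f(1)[symmetric] iso signed_plane_graph_def)
  ultimately show ?thesis
    by (simp add: signed_plane_graph_def)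
qed


section \<open>Link diagrams\<close>

lemma bij_betw_endo:
  assumes "finite S" "\<And>x. x \<in> S \<Longrightarrow> f x \<in> S" "inj_on f S"
  shows "bij_betw f S S"
  using assms endo_inj_surj[of S f] by (auto simp: bij_betw_def)

lemma link_diagramD:
  assumes "link_diagram D"
  shows "plane_graph D"
    and "\<And>d. d \<in> darts D \<Longrightarrow> nxt D (nxt D (nxt D (nxt D d))) = d"
    and "\<And>d. d \<in> darts D \<Longrightarrow> nxt D (nxt D d) \<noteq> d"
    and "\<And>d. d \<in> darts D \<Longrightarrow> over D (nxt D d) = (\<not> over D d)"
    and "\<And>d. d \<in> darts D \<Longrightarrow> prv D d = nxt D (nxt D (nxt D d))"
proof -
  show pl: "plane_graph D"
    using assms by (simp add: link_diagram_def)
  note P = plane_graphD[OF pl]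
  have *: "card (orbit (nxt D) d) = 4 \<and> over D (nxt D d) = (\<not> over D d)" if "d \<in> darts D" for d
    using assms that by (simp add: link_diagram_def)
  fix d
  assume d: "d \<in> darts D"
  show "over D (nxt D d) = (\<not> over D d)"
    using * d by blast
  have "d \<in> orbit (nxt D) d"
    by (rule self_in_orbit_bij[OF P(1,3) d])
  then show n4: "nxt D (nxt D (nxt D (nxt D d))) = d" and "nxt D (nxt D d) \<noteq> d"
    using card_orbit_4D[of d "nxt D"] * d by blast+
  show "prv D d = nxt D (nxt D (nxt D d))"
    using P d n4 by (intro prv_eqI) auto
qed

text \<open>
  With all vertices of valency 4 there are a quarter as many vertices and half as many edges as
  darts, so Euler's formula only concerns the number of regions.
\<close>

lemma link_diagram_iff:
  "link_diagram D \<longleftrightarrow>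
     finite (darts D) \<and> darts D \<noteq> {} \<and>
     (\<forall>d\<in>darts D. opp D d \<in> darts D \<and> opp D d \<noteq> d \<and> opp D (opp D d) = d) \<and>
     (\<forall>d\<in>darts D. nxt D d \<in> darts D \<and> nxt D (nxt D (nxt D (nxt D d))) = d \<and> nxt D (nxt D d) \<noteq> d \<and>
        over D (nxt D d) = (\<not> over D d)) \<and>
     connected_map D \<and> 4 * card (faces D) = card (darts D) + 8"
  (is "?L \<longleftrightarrow> ?R")
proof
  have euler: "(card (verts D) + card (faces D) = card (edges D) + 2) =
      (4 * card (faces D) = card (darts D) + 8)"
    if "finite (darts D)" "\<forall>d\<in>darts D. card (orbit (nxt D) d) = 4"
      "bij_betw (nxt D) (darts D) (darts D)"
      "\<forall>d\<in>darts D. opp D d \<in> darts D \<and> opp D d \<noteq> d \<and> opp D (opp D d) = d"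
  proof -
    have "4 * card (verts D) = card (darts D)"
      unfolding verts_def using that by (intro card_orbits) auto
    moreover have "2 * card (edges D) = card (darts D)"
      using that by (intro card_edges)
    ultimately show ?thesis
      by linarith
  qed
  show ?R if ?L
    using euler that link_diagramD[OF that] plane_graphD[of D] by (auto simp: link_diagram_def)
  show ?L if R: ?R
  proof -
    have "bij_betw (nxt D) (darts D) (darts D)"
      using R by (intro bij_betw_byWitness[of _ "\<lambda>d. nxt D (nxt D (nxt D d))"]) auto
    moreover have "\<forall>d\<in>darts D. card (orbit (nxt D) d) = 4"
      using R by (auto intro: card_orbit_4I)
    ultimately show ?thesis
      using R euler by (auto simp: link_diagram_def plane_graph_def)
  qed
qed

lemma face_step:
  assumes "plane_graph D" "d \<in> darts D"
  shows "face D (opp D (nxt D d)) = face D d"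
  using orbit_eq_bij[OF plane_graphD(1)[OF assms(1)] bij_face_step[OF assms(1)] assms(2) orbit.base]
  by (simp add: face_def)

text \<open>
  A colouring of corners that changes along \<open>opp\<close> and along \<open>nxt\<close> is constant on regions, because
  one step around a region is \<open>opp \<circ> nxt\<close> and changes the colour twice.  This is how the
  colouring of the parallel below is produced: on darts, where it is a parity.
\<close>

lemma checkerboard_of_colouring:
  assumes "plane_graph D"
    and "\<And>d. d \<in> darts D \<Longrightarrow> c (opp D d) \<longleftrightarrow> \<not> c d"
    and "\<And>d. d \<in> darts D \<Longrightarrow> c (nxt D d) \<longleftrightarrow> \<not> c d"
  defines "B \<equiv> face D ` {d \<in> darts D. c d}"
  shows "checkerboard D B" and "\<And>d. d \<in> darts D \<Longrightarrow> face D d \<in> B \<longleftrightarrow> c d"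
proof -
  note P = plane_graphD[OF assms(1)]
  have step: "(opp D \<circ> nxt D) e \<in> {e \<in> darts D. c e = c d}" if "e \<in> {e \<in> darts D. c e = c d}" for d e
    using that P(7,10) assms(2,3) by auto
  have const: "c e = c d" if "e \<in> face D d" "d \<in> darts D" for d e
    using orbit_closed[of e "opp D \<circ> nxt D" d "{e \<in> darts D. c e = c d}", OF _ _ step] that
    by (auto simp: face_def)
  show *: "face D d \<in> B \<longleftrightarrow> c d" if "d \<in> darts D" for d
  proof
    assume "face D d \<in> B"
    then obtain e where e: "e \<in> darts D" "c e" "face D d = face D e"
      by (auto simp: B_def)
    have "d \<in> face D d"
      unfolding face_def by (rule self_in_orbit_bij[OF P(1) bij_face_step[OF assms(1)] that])
    then show "c d"
      using const[of d e] e by auto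
  qed (use that in \<open>auto simp: B_def\<close>)
  show "checkerboard D B"
    using * P(7) assms(2) by (auto simp: checkerboard_def B_def faces_def)
qed

lemma checkerboardD:
  assumes "plane_graph D" "checkerboard D B" "d \<in> darts D"
  shows "face D (opp D d) \<in> B \<longleftrightarrow> face D d \<notin> B" "face D (nxt D d) \<in> B \<longleftrightarrow> face D d \<notin> B"
proof -
  have *: "face D (opp D d) \<in> B \<longleftrightarrow> face D d \<notin> B" if "d \<in> darts D" for d
    using assms that by (auto simp: checkerboard_def)
  then show "face D (opp D d) \<in> B \<longleftrightarrow> face D d \<notin> B"
    using assms(3) .
  show "face D (nxt D d) \<in> B \<longleftrightarrow> face D d \<notin> B"
    using *[of "nxt D d"] face_step[OF assms(1,3)] plane_graphD(10)[OF assms(1,3)] by simp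
qed


section \<open>Tait graphs\<close>

lemma tait_graph_simps [simp]:
  "darts (tait_graph D B) = {d \<in> darts D. face D d \<in> B}"
  "opp (tait_graph D B) d = nxt D (nxt D d)"
  "nxt (tait_graph D B) d = prv D (opp D d)"
  "pos (tait_graph D B) d = over D d"
  by (simp_all add: tait_graph_def)

text \<open>
  The vertices of the Tait graph are the black regions, its regions are the white ones, and its edges
  are the crossings; so Euler's formula for it is that of the diagram, where there are two more
  regions than crossings.  It is connected because a set \<open>U\<close> of black corners that is closed in the
  Tait graph gives, together with the white corners \<open>nxt ` U\<close> next to it, a closed set of darts of
  the diagram.  The sign of an edge is well defined because \<open>nxt \<circ> nxt\<close> keeps the strand.
\<close>

lemma signed_plane_graph_tait:
  assumes D: "link_diagram D" and B: "checkerboard D B"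
  shows "signed_plane_graph (tait_graph D B)"
proof -
  let ?T = "tait_graph D B" and ?n = "nxt D" and ?o = "opp D"
  note pl = link_diagramD(1)[OF D]
  note P = plane_graphD[OF pl] and L = link_diagramD(2-)[OF D] and C = checkerboardD[OF pl B]
  define S where "S = {d \<in> darts D. face D d \<in> B}"
  have S: "finite S" "S \<subseteq> darts D" "darts ?T = S"
    using P(1) by (auto simp: S_def)
  have oppT: "?n (?n d) \<in> S" if "d \<in> S" for d
    using that P(10) C by (auto simp: S_def)
  have nxtT: "prv D (?o d) \<in> S" if "d \<in> S" for d
    using that P(7,10) L(4) C by (auto simp: S_def)
  have step: "?o (?n d) \<in> S" if "d \<in> S" for d
    using that P(7,10) C by (auto simp: S_def)
  have inv: "prv D (?o (?o (?n d))) = d" "?o (?n (prv D (?o d))) = d" if "d \<in> S" for d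
    using that P(7,9,10) L(1,4) S(2) by (auto simp: subset_iff)
  have bij_step: "bij_betw (?o \<circ> ?n) S S"
    using inv step nxtT by (intro bij_betw_byWitness[of _ "\<lambda>d. prv D (?o d)"]) auto
  have bij_nxt: "bij_betw (\<lambda>d. prv D (?o d)) S S"
    using inv step nxtT by (intro bij_betw_byWitness[of _ "?o \<circ> ?n"]) auto
  have opp_img: "?o ` S = {d \<in> darts D. face D d \<notin> B}"
  proof
    show "?o ` S \<subseteq> {d \<in> darts D. face D d \<notin> B}"
      using P(7) C by (auto simp: S_def)
    show "{d \<in> darts D. face D d \<notin> B} \<subseteq> ?o ` S"
    proof
      fix d
      assume "d \<in> {d \<in> darts D. face D d \<notin> B}"
      then have "d = ?o (?o d)" "?o d \<in> S"
        using P(7,9) C by (auto simp: S_def)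
      then show "d \<in> ?o ` S"
        by blast
    qed
  qed
  have inj_opp: "inj_on ?o S"
    using P(9) S(2) by (intro inj_on_inverseI[of _ ?o]) auto
  have S_ne: "S \<noteq> {}"
  proof -
    obtain d where "d \<in> darts D"
      using P(2) by blast
    then have "d \<in> S \<or> ?o d \<in> S"
      using P(7) C(1) by (auto simp: S_def)
    then show ?thesis
      by blast
  qed
  have card_S: "2 * card S = card (darts D)"
  proof -
    have "darts D = S \<union> ?o ` S"
      unfolding opp_img by (auto simp: S_def)
    then have "card (darts D) = card S + card (?o ` S)"
      using S(1) by (metis (no_types, lifting) opp_img S_def card_Un_disjoint disjoint_iff
          finite_imageI mem_Collect_eq)
    then show ?thesis
      by (simp add: card_image inj_opp)
  qed
  have "connected_map ?T"
  proof (rule connected_mapI)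
    fix U
    assume U: "U \<subseteq> darts ?T" "U \<noteq> {}" "\<And>d. d \<in> U \<Longrightarrow> opp ?T d \<in> U" "\<And>d. d \<in> U \<Longrightarrow> nxt ?T d \<in> U"
    have US: "U \<subseteq> S" "finite U"
      using U(1) S finite_subset by auto
    have "bij_betw (\<lambda>d. prv D (?o d)) U U"
      using U(4) US bij_nxt by (intro bij_betw_endo) (auto simp: bij_betw_def intro: inj_on_subset)
    then have "U = (\<lambda>d. prv D (?o d)) ` U"
      by (simp add: bij_betw_def)
    then have stepU: "?o (?n d) \<in> U" if "d \<in> U" for d
      using inv(2) US(1) that by (metis (no_types, lifting) imageE subsetD)
    have "U \<union> ?n ` U = darts D"
    proof (rule connected_map_closed[OF P(5)])
      fix d
      assume d: "d \<in> U \<union> ?n ` U"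
      then show "?n d \<in> U \<union> ?n ` U"
        using U(3) by auto
      show "?o d \<in> U \<union> ?n ` U"
        using d
      proof
        assume dU: "d \<in> U"
        then have "prv D (?o d) \<in> U"
          using U(4) by simp
        moreover have "?n (prv D (?o d)) = ?o d"
          using dU US(1) S(2) P(7) L(1,4) by auto
        ultimately show ?thesis
          by (metis UnI2 imageI)
      qed (use stepU in auto)
    qed (use US S(2) U(2) P(10) in auto)
    moreover have "?n ` U \<inter> S = {}"
      using US(1) C(2) by (auto simp: S_def)
    ultimately show "U = darts ?T"
      using US(1) S by blast
  qed (use oppT nxtT S(3) in auto)
  moreover have "card (verts ?T) + card (faces ?T) = card (edges ?T) + 2"
  proof -
    have "orbit (\<lambda>d. prv D (?o d)) d = face D d" if "d \<in> S" for d
      unfolding face_def using that S(1) bij_step nxtT inv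
      by (intro orbit_inverse_eq[of S]) auto
    then have vT: "verts ?T = face D ` S"
      unfolding verts_def S(3) by (auto simp: tait_graph_def image_iff)
    have "card (faces ?T) = card (orbit (?o \<circ> ?n) ` ?o ` S)"
      unfolding faces_def face_def S(3)
    proof (rule card_orbits_iso[symmetric, OF S(1) _ inj_opp])
      have "bij_betw (\<lambda>d. ?n (?n d)) S S"
        using oppT L(1) S(2) by (intro bij_betw_byWitness[of _ "\<lambda>d. ?n (?n d)"]) auto
      with bij_nxt show "bij_betw (opp ?T \<circ> nxt ?T) S S"
        by (auto simp: tait_graph_def comp_def intro: bij_betw_trans[unfolded comp_def])
      show "(?o \<circ> ?n) (?o d) = ?o ((opp ?T \<circ> nxt ?T) d)" if "d \<in> S" for d
        using that S(2) L(1,4) P(7,10) by (auto simp: subset_iff)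
    qed
    then have fT: "card (faces ?T) = card (face D ` ?o ` S)"
      by (simp add: face_def[abs_def])
    have "faces D = face D ` S \<union> face D ` ?o ` S"
      unfolding faces_def opp_img by (auto simp: S_def)
    moreover have "face D ` S \<inter> face D ` ?o ` S = {}"
      unfolding opp_img by (auto simp: S_def)
    ultimately have "card (faces D) = card (verts ?T) + card (faces ?T)"
      unfolding vT fT using S(1) by (simp add: card_Un_disjoint)
    moreover have "2 * card (edges ?T) = card S"
      using card_edges[of ?T] S oppT L(1,2) by auto
    ultimately show ?thesis
      using card_S D unfolding link_diagram_iff by linarith
  qed
  ultimately have "plane_graph ?T"
    using S S_ne oppT L(1,2) bij_nxt unfolding plane_graph_def by (auto simp: tait_graph_def)
  moreover have "\<forall>d\<in>darts ?T. pos ?T (opp ?T d) = pos ?T d"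
    using P(10) L(3) by auto
  ultimately show ?thesis
    by (simp add: signed_plane_graph_def)
qed


section \<open>Parallels\<close>

lemma parallel_simps [simp]:
  "darts (parallel r D) = darts D \<times> {..<r} \<times> {..<r}"
  "opp (parallel r D) (d, i, j) =
     (if j = 0 then (opp D d, r - 1 - i, 0) else (nxt D (nxt D d), r - 1 - i, r - j))"
  "nxt (parallel r D) (d, i, j) = (nxt D d, r - 1 - j, i)"
  "over (parallel r D) (d, i, j) = over D d"
  by (simp_all add: parallel_def)

text \<open>
  The invariant set is shown to depend only on the first component of its members: going straight on
  through the grid moves along one copy of the strand, and a quarter turn at the end of the row
  exchanges the two directions of the grid.
\<close>

lemma connected_parallel:
  assumes D: "link_diagram D" and r: "r \<ge> 1"
  shows "connected_map (parallel r D)"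
proof (rule connected_mapI)
  let ?P = "parallel r D" and ?n = "nxt D" and ?o = "opp D"
  note P = plane_graphD[OF link_diagramD(1)[OF D]] and L = link_diagramD(2-)[OF D]
  show oppP: "opp ?P d \<in> darts ?P" and nxtP: "nxt ?P d \<in> darts ?P" if "d \<in> darts ?P" for d
    using that P(7,10) by auto
  fix S
  assume S: "S \<subseteq> darts ?P" "S \<noteq> {}" "\<And>d. d \<in> S \<Longrightarrow> opp ?P d \<in> S" "\<And>d. d \<in> S \<Longrightarrow> nxt ?P d \<in> S"
  have invol: "opp ?P (opp ?P d) = d" "nxt ?P (nxt ?P (nxt ?P (nxt ?P d))) = d" if "d \<in> darts ?P" for d
    using that P(7,9,10) L(1,2) by auto
  have opp_iff: "opp ?P d \<in> S \<longleftrightarrow> d \<in> S" if "d \<in> darts ?P" for d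
    using S(3) invol(1) that by metis
  have nxt_iff: "nxt ?P d \<in> S \<longleftrightarrow> d \<in> S" if "d \<in> darts ?P" for d
    using S(4) invol(2) that by metis
  have row: "(d, i, j) \<in> S \<longleftrightarrow> (d, i, 0) \<in> S" if "d \<in> darts D" "i < r" "j < r" for d i j
    using that(3)
  proof (induction j)
    case (Suc j)
    \<comment> \<open>one step straight on, to the next grid point\<close>
    have "nxt ?P (nxt ?P (opp ?P (d, i, Suc j))) = (d, i, j)"
      using that Suc.prems L(1) by simp
    moreover have "(d, i, Suc j) \<in> darts ?P"
      using that Suc.prems by simp
    ultimately have "(d, i, j) \<in> S \<longleftrightarrow> (d, i, Suc j) \<in> S"
      using oppP nxtP opp_iff nxt_iff by metis
    then show ?case
      using Suc by simp
  qed simp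
  have first: "(d, i, 0) \<in> S \<longleftrightarrow> (?n (?n (?n d)), 0, 0) \<in> S" if "d \<in> darts D" "i < r" for d i
  proof -
    \<comment> \<open>a quarter turn exchanges the position along the strand with the number of the copy\<close>
    have "nxt ?P (?n (?n (?n d)), 0, r - 1 - i) = (d, i, 0)"
      using that L(1) by simp
    moreover have "(?n (?n (?n d)), 0, r - 1 - i) \<in> darts ?P"
      using that P(10) by simp
    ultimately show ?thesis
      using nxt_iff row[of "?n (?n (?n d))" 0 "r - 1 - i"] that P(10) by (metis SigmaD1 SigmaD2 lessThan_iff parallel_simps(1))
  qed
  have all: "(d, i, j) \<in> S \<longleftrightarrow> (d, 0, 0) \<in> S" if "d \<in> darts D" "i < r" "j < r" for d i j
    using row[of d i j] first[of d i] first[of d 0] that by simp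
  have "{d \<in> darts D. (d, 0, 0) \<in> S} = darts D"
  proof (rule connected_map_closed[OF P(5)])
    show "{d \<in> darts D. (d, 0, 0) \<in> S} \<noteq> {}"
      using S(1,2) all by fastforce
    fix d
    assume d: "d \<in> {d \<in> darts D. (d, 0, 0) \<in> S}"
    then show "?o d \<in> {d \<in> darts D. (d, 0, 0) \<in> S}"
      using S(3)[of "(d, 0, 0)"] all[of "?o d" "r - 1" 0] r P(7) by auto
    show "?n d \<in> {d \<in> darts D. (d, 0, 0) \<in> S}"
      using d S(4)[of "(d, 0, 0)"] all[of "?n d" "r - 1" 0] r P(10) by auto
  qed auto
  then have "(d, i, j) \<in> S" if "(d, i, j) \<in> darts ?P" for d i j
    using all[of d i j] that by auto
  then have "darts ?P \<subseteq> S"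
    by auto
  then show "S = darts ?P"
    using S(1) by blast
qed

text \<open>
  Three kinds of region occur.  The corners \<open>(d, 0, 0)\<close> reproduce the regions of \<open>D\<close>.  All others
  are quadrilaterals: those running along an edge of \<open>D\<close>, between two neighbouring copies of it, and
  those inside a grid.  With \<open>n\<close> darts in \<open>D\<close> the last two kinds have \<open>2(r - 1)n\<close> and
  \<open>(r - 1)\<^sup>2n\<close> corners.
\<close>

lemma card_faces_parallel:
  assumes D: "link_diagram D" and r: "r \<ge> 1"
  shows "4 * card (faces (parallel r D)) = 4 * card (faces D) + (r * r - 1) * card (darts D)"
proof -
  let ?P = "parallel r D" and ?n = "nxt D" and ?o = "opp D"
  define f where "f = opp ?P \<circ> nxt ?P"
  note pl = link_diagramD(1)[OF D]
  note P = plane_graphD[OF pl] and L = link_diagramD(2-)[OF D]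
  have n_eq: "?n d = ?n e \<longleftrightarrow> d = e" if "d \<in> darts D" "e \<in> darts D" for d e
    using L(1) that by metis
  have f: "f (d, i, j) =
      (if i = 0 then (?o (?n d), j, 0) else (?n (?n (?n d)), j, r - i))" if "i < r" "j < r" for d i j
    using that by (auto simp: f_def)
  define X where "X = darts D \<times> {0 :: nat} \<times> {0 :: nat}"
  define Y where "Y = darts D \<times> ({0} \<times> {0<..<r} \<union> {0<..<r} \<times> {0})"
  define Z where "Z = darts D \<times> {0<..<r} \<times> {0<..<r}"
  have XYZ: "darts ?P = X \<union> Y \<union> Z"
    using r by (auto simp: X_def Y_def Z_def)
  have fin: "finite X" "finite Y" "finite Z"
    using P(1) by (auto simp: X_def Y_def Z_def)
  have inj: "inj_on f (darts ?P)"
    unfolding inj_on_def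
  proof (clarsimp simp del: parallel_simps(2,3))
    fix d i j d' i' j'
    assume *: "d \<in> darts D" "i < r" "j < r" "d' \<in> darts D" "i' < r" "j' < r"
      "f (d, i, j) = f (d', i', j')"
    then show "d = d' \<and> i = i' \<and> j = j'"
      using P(9,10) n_eq by (auto simp: f split: if_splits) (metis P(9,10) n_eq)+
  qed
  have closed: "f x \<in> X" if "x \<in> X" for x
    using that r P(7,10) by (auto simp: X_def f)
  have closedY: "f x \<in> Y" if "x \<in> Y" for x
    using that r P(7,10) by (auto simp: Y_def f)
  have closedZ: "f x \<in> Z" if "x \<in> Z" for x
    using that r P(7,10) by (auto simp: Z_def f)
  have bij: "bij_betw f X X" "bij_betw f Y Y" "bij_betw f Z Z"
    using fin closed closedY closedZ inj unfolding XYZ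
    by (auto intro!: bij_betw_endo intro: inj_on_subset)
  have "faces ?P = orbit f ` X \<union> (orbit f ` Y \<union> orbit f ` Z)"
    unfolding faces_def face_def f_def[symmetric] XYZ by auto
  \<comment> \<open>The three sets are invariant, hence no region is counted twice.\<close>
  moreover have "orbit f ` X \<inter> (orbit f ` Y \<union> orbit f ` Z) = {}" "orbit f ` Y \<inter> orbit f ` Z = {}"
  proof -
    have *: "A = A'" if "orbit f x = orbit f x'" "x \<in> A" "x' \<in> A'" "bij_betw f A A" "bij_betw f A' A'"
      "A \<in> {X, Y, Z}" "A' \<in> {X, Y, Z}" for x x' A A'
    proof -
      have "orbit f x \<subseteq> A" "orbit f x' \<subseteq> A'"
        using orbit_subset_bij that(2-5) by metis+
      moreover have "f x \<in> orbit f x"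
        by (rule orbit.base)
      ultimately have "A \<inter> A' \<noteq> {}"
        using that(1) by auto
      then show ?thesis
        using that(6,7) by (auto simp: X_def Y_def Z_def)
    qed
    have "X \<inter> Y = {}" "X \<inter> Z = {}" "Y \<inter> Z = {}"
      by (auto simp: X_def Y_def Z_def)
    then show "orbit f ` X \<inter> (orbit f ` Y \<union> orbit f ` Z) = {}" "orbit f ` Y \<inter> orbit f ` Z = {}"
      using *[of _ _ X Y] *[of _ _ X Z] *[of _ _ Y Z] bij by blast+
  qed
  ultimately have "card (faces ?P) = card (orbit f ` X) + (card (orbit f ` Y) + card (orbit f ` Z))"
    using fin by (simp add: card_Un_disjoint)
  moreover have "card (orbit f ` X) = card (faces D)"
  proof -
    have "X = (\<lambda>d. (d, 0, 0)) ` darts D"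
      by (auto simp: X_def)
    then show ?thesis
      unfolding faces_def face_def
      using card_orbits_iso[OF P(1) bij_face_step[OF pl], of "\<lambda>d. (d, 0, 0)" f] r
      by (simp add: f inj_on_def)
  qed
  moreover have "4 * card (orbit f ` Y) = card Y"
  proof (rule card_orbits[OF fin(2) bij(2)])
    fix x
    assume "x \<in> Y"
    moreover have "?n (?n (?n (?o (?n d)))) \<noteq> d" "?o (?n (?n (?n (?n (?o (?n d)))))) = ?n d"
      if "d \<in> darts D" for d
      using that P(7-10) L(1) by (auto simp: n_eq) (metis L(1) P(7,8,10))
    ultimately show "card (orbit f x) = 4"
      using P(7-10) L(1) by (intro card_orbit_4I) (auto simp: Y_def f)
  qed
  moreover have "4 * card (orbit f ` Z) = card Z"
    using L(1,2) P(10)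
    by (intro card_orbits[OF fin(3) bij(3)] card_orbit_4I) (auto simp: Z_def f)
  moreover have "card Y = 2 * (r - 1) * card (darts D)" "card Z = (r - 1) * (r - 1) * card (darts D)"
  proof -
    have "card ({0} \<times> {0<..<r} \<union> {0<..<r} \<times> {0}) = 2 * (r - 1)"
      by (subst card_Un_disjoint) auto
    then show "card Y = 2 * (r - 1) * card (darts D)"
      by (simp add: Y_def card_cartesian_product)
    show "card Z = (r - 1) * (r - 1) * card (darts D)"
      by (simp add: Z_def card_cartesian_product)
  qed
  moreover have "r * r - 1 = 2 * (r - 1) + (r - 1) * (r - 1)"
    using r by (cases r) auto
  ultimately show ?thesis
    by (simp add: algebra_simps)
qed

lemma link_diagram_parallel:
  assumes D: "link_diagram D" and r: "r \<ge> 1"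
  shows "link_diagram (parallel r D)"
proof -
  note P = plane_graphD[OF link_diagramD(1)[OF D]] and L = link_diagramD(2-)[OF D]
  have "4 * card (faces D) = card (darts D) + 8"
    using D unfolding link_diagram_iff by simp
  moreover have "r * r * card (darts D) = (r * r - 1) * card (darts D) + card (darts D)"
    using r by (cases r) auto
  ultimately have "4 * card (faces (parallel r D)) = card (darts (parallel r D)) + 8"
    using card_faces_parallel[OF D r] by (simp add: card_cartesian_product mult_ac)
  then show ?thesis
    using P(1,2,7-10) L(1-3) r connected_parallel[OF D r] unfolding link_diagram_iff
    by (auto simp: lessThan_empty_iff)
qed


section \<open>The overlay of a dual with a drawn graph\<close>

lemma overlay_dual_simps [simp]:
  "(Inl g, i) \<in> darts (overlay_dual M T p) \<longleftrightarrow> g \<in> darts M \<and> i \<le> length (dual_points T p g)"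
  "(Inr t, i) \<in> darts (overlay_dual M T p) \<longleftrightarrow> t \<in> darts T \<and> i \<le> length (p t)"
  "opp (overlay_dual M T p) (Inl g, i) = (Inl (opp M g), length (dual_points T p g) - i)"
  "opp (overlay_dual M T p) (Inr t, i) = (Inr (opp T t), length (p t) - i)"
  "nxt (overlay_dual M T p) (Inl g, 0) = (Inl (prv M (opp M g)), 0)"
  "nxt (overlay_dual M T p) (Inr t, 0) = (Inr (nxt T t), 0)"
  "dual_points T p g ! k = (t, j) \<Longrightarrow>
     nxt (overlay_dual M T p) (Inl g, Suc k) = (Inr t, Suc j)"
  "k < length (p t) \<Longrightarrow>
     nxt (overlay_dual M T p) (Inr t, Suc k) = (Inl (opp M (p t ! k)), Suc 0)"
  "pos (overlay_dual M T p) (Inl g, i) = (\<not> pos M g)"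
  "pos (overlay_dual M T p) (Inr t, i) = pos T t"
  by (auto simp: overlay_dual_def overlay_def dual_def path_points_def)

lemma length_dual_points: "length (dual_points T p d) \<le> 1"
  by (simp add: dual_points_def)

lemma dual_points_unique:
  assumes "t \<in> darts T" "i < length (p t)" "p t ! i = d"
    and "\<And>t' i'. t' \<in> darts T \<Longrightarrow> i' < length (p t') \<Longrightarrow> p t' ! i' = d \<Longrightarrow> t' = t \<and> i' = i"
  shows "dual_points T p d = [(t, i)]"
proof -
  have "(THE (t, i). t \<in> darts T \<and> i < length (p t) \<and> p t ! i = d) = (t, i)"
  proof (rule the_equality)
    fix x
    assume "case x of (t, i) \<Rightarrow> t \<in> darts T \<and> i < length (p t) \<and> p t ! i = d"
    then show "x = (t, i)"
      using assms(4)[of "fst x" "snd x"] by (cases x) auto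
  qed (use assms(1-3) in simp)
  moreover have "\<exists>t\<in>darts T. d \<in> set (p t)"
    using assms(1-3) by (auto simp: in_set_conv_nth)
  ultimately show ?thesis
    by (simp add: dual_points_def)
qed

lemma dual_points_map:
  assumes "inj_on f (darts M)" "d \<in> darts M"
    and "\<And>t. t \<in> darts T \<Longrightarrow> set (p t) \<subseteq> darts M" "\<And>t. t \<in> darts T \<Longrightarrow> q t = map f (p t)"
  shows "dual_points T q (f d) = dual_points T p d"
proof -
  have eq: "f x = f d \<longleftrightarrow> x = d" if "x \<in> set (p t)" "t \<in> darts T" for x t
    using assms(1-3) that by (metis inj_onD subsetD)
  have "(t \<in> darts T \<and> i < length (q t) \<and> q t ! i = f d) =
      (t \<in> darts T \<and> i < length (p t) \<and> p t ! i = d)" for t i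
    using eq assms(4) by (metis length_map nth_map nth_mem)
  moreover have "(\<exists>t\<in>darts T. f d \<in> set (q t)) = (\<exists>t\<in>darts T. d \<in> set (p t))"
    using eq assms(4) by (auto simp: image_iff) metis+
  ultimately show ?thesis
    unfolding dual_points_def by simp
qed

lemma prv_map_iso:
  assumes "map_iso f M N" "plane_graph M" "plane_graph N" "d \<in> darts M"
  shows "prv N (f d) = f (prv M d)" "prv M d \<in> darts M"
proof -
  have "d \<in> nxt M ` darts M"
    using plane_graphD(3)[OF assms(2)] assms(4) by (simp add: bij_betw_def)
  then obtain e where e: "e \<in> darts M" "nxt M e = d"
    by blast
  have "prv M d = e"
    using e plane_graphD(4)[OF assms(2)] by (auto intro: prv_eqI)
  moreover have "prv N (f d) = f e"
    using e assms(1) plane_graphD(4)[OF assms(3)]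
    by (intro prv_eqI) (auto simp: map_iso_def bij_betw_def)
  ultimately show "prv N (f d) = f (prv M d)" "prv M d \<in> darts M"
    using e by auto
qed

text \<open>
  The overlay depends only on the drawing up to isomorphism.  This replaces the graph built by the
  recursion, whose darts are nested pieces, by the Tait graph of a parallel.  That the first overlay
  is closed under \<open>opp\<close> and \<open>nxt\<close> follows from the same property of the second one.
\<close>

lemma map_iso_overlay_dual:
  assumes iso: "map_iso f M N" and pl: "plane_graph M" "plane_graph N"
    and p: "\<And>t. t \<in> darts T \<Longrightarrow> set (p t) \<subseteq> darts M" "\<And>t. t \<in> darts T \<Longrightarrow> q t = map f (p t)"
    and closed: "\<And>x. x \<in> darts (overlay_dual N T q) \<Longrightarrow> opp (overlay_dual N T q) x \<in> darts (overlay_dual N T q)"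
      "\<And>x. x \<in> darts (overlay_dual N T q) \<Longrightarrow> nxt (overlay_dual N T q) x \<in> darts (overlay_dual N T q)"
  shows "map_iso (\<lambda>(s, i). (map_sum f id s, i)) (overlay_dual M T p) (overlay_dual N T q)"
    (is "map_iso ?h ?G ?H")
proof -
  have f: "f ` darts M = darts N" "inj_on f (darts M)"
    using iso by (auto simp: map_iso_def bij_betw_def)
  have M: "opp M d \<in> darts M \<and> nxt M d \<in> darts M \<and>
      f (opp M d) = opp N (f d) \<and> f (nxt M d) = nxt N (f d) \<and> pos N (f d) = pos M d"
    if "d \<in> darts M" for d
    using iso that by (auto simp: map_iso_def)
  have dp: "dual_points T q (f d) = dual_points T p d" if "d \<in> darts M" for d
    by (intro dual_points_map[OF f(2) that]) (use p in auto)
  have inl: "(Inl (f d), i) \<in> darts ?H \<longleftrightarrow> (Inl d, i) \<in> darts ?G" if "d \<in> darts M" for d i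
    using that f(1) dp by auto
  have inr: "(Inr t, i) \<in> darts ?H \<longleftrightarrow> (Inr t, i) \<in> darts ?G" for t i
    using p(2) by auto
  have "?h ` darts ?G = darts ?H"
  proof
    show "?h ` darts ?G \<subseteq> darts ?H"
    proof (rule image_subsetI)
      fix x
      assume "x \<in> darts ?G"
      then show "?h x \<in> darts ?H"
        using inl inr by (cases x; cases "fst x") auto
    qed
    show "darts ?H \<subseteq> ?h ` darts ?G"
    proof
      fix y
      assume y: "y \<in> darts ?H"
      obtain s i where si: "y = (s, i)"
        by (cases y)
      show "y \<in> ?h ` darts ?G"
      proof (cases s)
        case (Inl e)
        then obtain d where d: "d \<in> darts M" "e = f d"
          using y si f(1) by auto
        then have "(Inl d, i) \<in> darts ?G" "y = ?h (Inl d, i)"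
          using y inl[of d i] unfolding si Inl by auto
        then show ?thesis
          by blast
      next
        case (Inr t)
        then have "(Inr t, i) \<in> darts ?G" "y = ?h (Inr t, i)"
          using y inr[of t i] unfolding si Inr by auto
        then show ?thesis
          by blast
      qed
    qed
  qed
  moreover have "inj_on ?h (darts ?G)"
  proof (rule inj_onI)
    fix x y
    assume "x \<in> darts ?G" "y \<in> darts ?G" "?h x = ?h y"
    then show "x = y"
      using f(2) by (cases x; cases y; cases "fst x"; cases "fst y") (auto dest: inj_onD)
  qed
  moreover have "opp ?G x \<in> darts ?G \<and> nxt ?G x \<in> darts ?G \<and>
      ?h (opp ?G x) = opp ?H (?h x) \<and> ?h (nxt ?G x) = nxt ?H (?h x) \<and> pos ?H (?h x) = pos ?G x"
    if x: "x \<in> darts ?G" for x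
  proof -
    have hx: "?h x \<in> darts ?H"
      using x calculation(1) by blast
    note cl = closed[OF hx]
    obtain s i where si: "x = (s, i)"
      by (cases x)
    show ?thesis
    proof (cases s)
      case (Inl d)
      then have d: "d \<in> darts M" and i: "i \<le> length (dual_points T p d)"
        using x si by auto
      have o: "opp M d \<in> darts M"
        using M d by blast
      note v = prv_map_iso[OF iso pl o]
      show ?thesis
      proof (cases i)
        case 0
        then show ?thesis
          using cl M[OF d] d v dp[OF d] dp[OF o] unfolding si Inl 0
          by (auto simp: dp inl[symmetric] simp del: overlay_dual_simps(1))
      next
        case (Suc k)
        then have k: "k = 0" "length (dual_points T p d) = 1"
          using i length_dual_points[of T p d] by auto
        obtain t j where tj: "dual_points T p d = [(t, j)]"
          using k(2) by (cases "dual_points T p d") auto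
        have nG: "nxt ?G x = (Inr t, Suc j)" and nH: "nxt ?H (?h x) = (Inr t, Suc j)"
          using tj dp[OF d] by (simp_all add: si Inl Suc k)
        have "opp ?G x = (Inl (opp M d), 0)" "opp ?H (?h x) = (Inl (f (opp M d)), 0)"
          using tj dp[OF d] M[OF d] by (simp_all add: si Inl Suc k)
        then show ?thesis
          using cl(2) o M[OF d] unfolding nG nH by (simp add: inr si Inl del: overlay_dual_simps(2))
      qed
    next
      case (Inr t)
      then have t: "t \<in> darts T" and i: "i \<le> length (p t)"
        using x si by auto
      have l: "length (q t) = length (p t)"
        using p(2)[OF t] by simp
      show ?thesis
      proof (cases i)
        case 0
        then show ?thesis
          using cl l inr unfolding si Inr 0 by (simp del: overlay_dual_simps(2))
      next
        case (Suc k)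
        then have k: "k < length (p t)"
          using i by simp
        define d where "d = p t ! k"
        have d: "d \<in> darts M" "q t ! k = f d"
          using k p[OF t] by (auto simp: d_def)
        have nG: "nxt ?G x = (Inl (opp M d), Suc 0)" and nH: "nxt ?H (?h x) = (Inl (f (opp M d)), Suc 0)"
          using k l d M[OF d(1)] by (simp_all add: si Inr Suc d_def)
        have oG: "opp ?G x = (Inr (opp T t), length (p t) - Suc k)"
          and oH: "opp ?H (?h x) = (Inr (opp T t), length (p t) - Suc k)"
          using l by (simp_all add: si Inr Suc)
        show ?thesis
          using cl M[OF d(1)] inl[of "opp M d" "Suc 0"] unfolding nG nH oG oH
          by (simp add: inr si Inr del: overlay_dual_simps(1,2))
      qed
    qed
  qed
  ultimately show ?thesis
    by (auto simp: map_iso_def bij_betw_def)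
qed


section \<open>Inserting a diagonal\<close>

text \<open>
  An edge of the Tait graph of \<open>D\<close> crosses the grid between opposite black corners, and the corner
  \<open>(0, 0)\<close> lies between \<open>t\<close> and \<open>nxt t\<close>, so this is its path in the Tait graph of the parallel.
\<close>

definition diagonal :: "nat \<Rightarrow> 'd \<Rightarrow> ('d \<times> nat \<times> nat) list" where
  "diagonal r t = map (\<lambda>m. (t, m, m)) [0..<r]"

text \<open>
  The colour alternates with \<open>i + j\<close> inside a grid.  For odd \<open>r\<close> the regions \<open>(d, 0, 0)\<close> keep
  their colour from \<open>D\<close>; for even \<open>r\<close> they are all black.  Both are forced by the recursion:
  the black regions of \<open>D\<close> are vertices of \<open>T\<close> at every stage, and a white one is a region of
  \<open>T\<close>, hence a vertex of the dual of \<open>T\<close>, and so on alternately.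
\<close>

definition parallel_black :: "nat \<Rightarrow> 'd diagram \<Rightarrow> 'd set set \<Rightarrow> ('d \<times> nat \<times> nat) \<Rightarrow> bool" where
  "parallel_black r D B = (\<lambda>(d, i, j). (odd r \<longrightarrow> face D d \<in> B) = even (i + j))"

definition parallel_faces :: "nat \<Rightarrow> 'd diagram \<Rightarrow> 'd set set \<Rightarrow> ('d \<times> nat \<times> nat) set set" where
  "parallel_faces r D B =
     face (parallel r D) ` {x \<in> darts (parallel r D). parallel_black r D B x}"

abbreviation tait_parallel :: "nat \<Rightarrow> 'd diagram \<Rightarrow> 'd set set \<Rightarrow> ('d \<times> nat \<times> nat) sgraph" where
  "tait_parallel r D B \<equiv> tait_graph (parallel r D) (parallel_faces r D B)"

text \<open>
  A dart \<open>g = (d, i, j)\<close> of the dual passes from the left to the right of \<open>g\<close>, so at the crossing it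
  starts from the corner before \<open>g\<close>, which is the white corner of \<open>prv g = (e, j, R - 1 - i)\<close> with
  \<open>e = prv d\<close>.  Its grid point has to be renumbered in a grid of size \<open>R + 1\<close> that contains the
  new diagonal.  If \<open>d\<close> is black, then \<open>e\<close> is white and the diagonal separates the corner of
  \<open>e\<close> from the opposite one: points on the side of that corner (\<open>j < i\<close>) keep their two
  coordinates, and on the other side both increase by 1.  A point on the old diagonal (\<open>i = j\<close>) is where
  the dual edge is cut by the edge of \<open>T\<close>; its two pieces, numbered by \<open>k\<close>, fall on the two
  sides.  If \<open>d\<close> is white, then \<open>e\<close> is black, the diagonal starts at its corner, and exactly one of
  the coordinates increases, depending on the side; the case \<open>i + j = R - 1\<close> does not arise, because
  of the colours.
\<close>

fun insert_diagonal ::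
  "nat \<Rightarrow> 'd diagram \<Rightarrow> 'd set set \<Rightarrow> (('d \<times> nat \<times> nat) + 'd) \<times> nat \<Rightarrow> 'd \<times> nat \<times> nat" where
  "insert_diagonal R D B (Inr t, k) = (t, k, k)"
| "insert_diagonal R D B (Inl (d, i, j), k) =
     (let e = nxt D (nxt D (nxt D d)) in
      if face D d \<in> B
      then if j < i \<or> i = j \<and> k = 0 then (e, j, R - 1 - i) else (e, Suc j, R - i)
      else if i + j < R - 1 then (e, j, R - i) else (e, Suc j, R - 1 - i))"

context
  fixes D :: "'d diagram" and B :: "'d set set"
  assumes D: "link_diagram D" and B: "checkerboard D B"
begin

lemmas plane = plane_graphD[OF link_diagramD(1)[OF D]]
lemmas link = link_diagramD(2-)[OF D]
lemmas colour = checkerboardD[OF link_diagramD(1)[OF D] B]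

lemma parallel_colouring:
  assumes "r \<ge> 1"
  shows "checkerboard (parallel r D) (parallel_faces r D B)"
    and "\<And>x. x \<in> darts (parallel r D) \<Longrightarrow>
      face (parallel r D) x \<in> parallel_faces r D B \<longleftrightarrow> parallel_black r D B x"
proof -
  note pl = link_diagramD(1)[OF link_diagram_parallel[OF D assms]]
  have opp: "parallel_black r D B (opp (parallel r D) x) = (\<not> parallel_black r D B x)"
    if "x \<in> darts (parallel r D)" for x
  proof -
    obtain d i j where x: "x = (d, i, j)"
      by (cases x)
    have "d \<in> darts D" "i < r" "j < r"
      using that by (auto simp: x)
    then show ?thesis
      using plane(10) colour
      by (cases "face D d \<in> B"; cases "j = 0"; simp add: x parallel_black_def; presburger)
  qed
  have nxt: "parallel_black r D B (nxt (parallel r D) x) = (\<not> parallel_black r D B x)"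
    if "x \<in> darts (parallel r D)" for x
  proof -
    obtain d i j where x: "x = (d, i, j)"
      by (cases x)
    have "d \<in> darts D" "i < r" "j < r"
      using that by (auto simp: x)
    then show ?thesis
      using colour by (cases "face D d \<in> B"; simp add: x parallel_black_def; presburger)
  qed
  show "checkerboard (parallel r D) (parallel_faces r D B)"
    using checkerboard_of_colouring(1)[OF pl opp nxt] by (simp add: parallel_faces_def)
  show "face (parallel r D) x \<in> parallel_faces r D B \<longleftrightarrow> parallel_black r D B x"
    if "x \<in> darts (parallel r D)" for x
    using checkerboard_of_colouring(2)[OF pl opp nxt that] by (simp add: parallel_faces_def)
qed

lemma signed_plane_graph_tait_parallel:
  assumes "r \<ge> 1"
  shows "signed_plane_graph (tait_parallel r D B)"
  using signed_plane_graph_tait link_diagram_parallel[OF D assms] parallel_colouring(1)[OF assms]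
  by blast

lemma darts_tait_parallel:
  assumes "r \<ge> 1"
  shows "(d, i, j) \<in> darts (tait_parallel r D B) \<longleftrightarrow>
    d \<in> darts D \<and> i < r \<and> j < r \<and> (odd r \<longrightarrow> face D d \<in> B) = even (i + j)"
  using parallel_colouring(2)[OF assms, of "(d, i, j)"] by (auto simp: parallel_black_def)

lemma nxt_tait_parallel:
  assumes "r \<ge> 1" "d \<in> darts D" "i < r" "j < r"
  shows "nxt (tait_parallel r D B) (d, i, j) =
    (if j = 0 then (nxt D (nxt D (nxt D (opp D d))), 0, i) else (nxt D d, r - j, i))"
proof -
  note E = link_diagram_parallel[OF D assms(1)]
  have "(d, i, j) \<in> darts (parallel r D)"
    using assms by simp
  then have "opp (parallel r D) (d, i, j) \<in> darts (parallel r D)"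
    by (rule plane_graphD(7)[OF link_diagramD(1)[OF E]])
  then show ?thesis
    using assms plane(7,10) link(1) by (simp add: link_diagramD(5)[OF E])
qed

text \<open>
  This is the next dart around a vertex of the dual, hence the \<open>nxt\<close> of the overlay below.
\<close>

lemma prv_tait_parallel:
  assumes "r \<ge> 1" "(d, i, j) \<in> darts (tait_parallel r D B)"
  shows "prv (tait_parallel r D B) (opp (tait_parallel r D B) (d, i, j)) =
    (if i = r - 1 then (opp D (nxt D (nxt D (nxt D d))), r - 1 - j, 0) else (nxt D d, r - 1 - j, Suc i))"
  (is "?l = ?r")
proof -
  note pl = signed_plane_graph_tait[OF link_diagram_parallel[OF D assms(1)] parallel_colouring(1)[OF assms(1)]]
  note d = assms(2)[unfolded darts_tait_parallel[OF assms(1)]]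
  show ?thesis
  proof (rule prv_eqI)
    show "inj_on (nxt (tait_parallel r D B)) (darts (tait_parallel r D B))"
      using pl plane_graphD(4) unfolding signed_plane_graph_def by blast
    show "?r \<in> darts (tait_parallel r D B)"
      using d plane(7,10) colour assms(1)
      by (auto simp: darts_tait_parallel simp del: tait_graph_simps)
    show "nxt (tait_parallel r D B) ?r = opp (tait_parallel r D B) (d, i, j)"
      using d plane(7,9,10) link(1) assms(1)
      by (auto simp: nxt_tait_parallel simp del: tait_graph_simps(3))
  qed
qed

text \<open>
  Only the corners on the diagonals of the grids lie on the drawing of \<open>T\<close>, each of them once.
\<close>

lemma dual_points_diagonal:
  assumes "R \<ge> 1" "(d, i, j) \<in> darts (tait_parallel R D B)"
  shows "dual_points (tait_graph D B) (diagonal R) (d, i, j) =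
    (if face D d \<in> B \<and> i = j then [(d, i)] else [])"
proof (cases "face D d \<in> B \<and> i = j")
  case True
  then show ?thesis
    using assms(2)[unfolded darts_tait_parallel[OF assms(1)]]
    by (simp, intro dual_points_unique) (auto simp: diagonal_def)
next
  case False
  then show ?thesis
    by (auto simp: dual_points_def diagonal_def)
qed

text \<open>
  The step of the recursion.  That the renumbering commutes with \<open>opp\<close> and \<open>nxt\<close> is a comparison
  of coordinates in each of its cases.  Signs agree because the dual changes them and \<open>prv d\<close> is on
  the other strand than \<open>d\<close>.  The map is onto without any computation: its image is closed and the
  Tait graph of the larger parallel is connected.
\<close>

lemma map_iso_insert_diagonal:
  assumes R: "R \<ge> 1"
  defines "G \<equiv> overlay_dual (tait_parallel R D B) (tait_graph D B) (diagonal R)"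
  shows "map_iso (insert_diagonal R D B) G (tait_parallel (Suc R) D B)"
    (is "map_iso ?F G ?K")
proof -
  let ?n = "nxt D" and ?o = "opp D" and ?M = "tait_parallel R D B"
  have n_eq: "?n d = ?n e \<longleftrightarrow> d = e" if "d \<in> darts D" "e \<in> darts D" for d e
    using link(1) that by metis
  have dartsK: "(d, i, j) \<in> darts ?K \<longleftrightarrow>
      d \<in> darts D \<and> i < Suc R \<and> j < Suc R \<and> (even R \<longrightarrow> face D d \<in> B) = even (i + j)" for d i j
    using darts_tait_parallel[of "Suc R"] by simp
  have dartsM: "(d, i, j) \<in> darts ?M \<longleftrightarrow>
      d \<in> darts D \<and> i < R \<and> j < R \<and> (odd R \<longrightarrow> face D d \<in> B) = even (i + j)" for d i j
    using darts_tait_parallel[OF R] by simp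
  have dartsG_l: "(Inl (d, i, j), k) \<in> darts G \<longleftrightarrow>
      d \<in> darts D \<and> i < R \<and> j < R \<and> (odd R \<longrightarrow> face D d \<in> B) = even (i + j) \<and>
      (k = 0 \<or> k = 1 \<and> face D d \<in> B \<and> i = j)" for d i j k
  proof (cases "(d, i, j) \<in> darts ?M")
    case True
    then show ?thesis
      using dartsM[of d i j] by (auto simp: G_def dual_points_diagonal[OF R True] simp del: tait_graph_simps)
  next
    case False
    then show ?thesis
      using dartsM[of d i j] by (auto simp: G_def simp del: tait_graph_simps)
  qed
  have dartsG_r: "(Inr t, k) \<in> darts G \<longleftrightarrow> t \<in> darts D \<and> face D t \<in> B \<and> k \<le> R" for t k
    by (auto simp: G_def diagonal_def)
  have black: "face D (?n d) \<in> B \<longleftrightarrow> face D d \<notin> B" "face D (?o d) \<in> B \<longleftrightarrow> face D d \<notin> B"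
    "?n d \<in> darts D" "?o d \<in> darts D" "?n (?n (?n (?n d))) = d" "?o (?o d) = d"
    "over D (?n d) \<longleftrightarrow> \<not> over D d"
    if "d \<in> darts D" for d
    using that colour plane link by auto
  have F_l: "?F (Inl (d, i, j), k) = (?n (?n (?n d)),
      if face D d \<in> B
      then if j < i \<or> i = j \<and> k = 0 then (j, R - 1 - i) else (Suc j, R - i)
      else if i + j < R - 1 then (j, R - i) else (Suc j, R - 1 - i))" for d i j k
    by (simp add: Let_def)
  have oppG_l: "opp G (Inl (d, i, j), k) =
      (Inl (?n (?n d), R - 1 - i, R - 1 - j), (if face D d \<in> B \<and> i = j then 1 else 0) - k)"
    and nxtG_l0: "nxt G (Inl (d, i, j), 0) = (Inl (if i = R - 1
      then (?o (?n (?n (?n d))), R - 1 - j, 0) else (?n d, R - 1 - j, Suc i)), 0)"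
    and nxtG_l1: "k = Suc 0 \<Longrightarrow> nxt G (Inl (d, i, j), k) = (Inr d, Suc i)"
    and posG_l: "pos G (Inl (d, i, j), k) = (\<not> over D d)"
    if "(Inl (d, i, j), k) \<in> darts G" for d i j k
  proof -
    note d = that[unfolded dartsG_l]
    then have M: "(d, i, j) \<in> darts ?M"
      using dartsM by blast
    note dp = dual_points_diagonal[OF R M]
    show "opp G (Inl (d, i, j), k) =
        (Inl (?n (?n d), R - 1 - i, R - 1 - j), (if face D d \<in> B \<and> i = j then 1 else 0) - k)"
      using d dp by (auto simp: G_def)
    show "nxt G (Inl (d, i, j), 0) = (Inl (if i = R - 1
        then (?o (?n (?n (?n d))), R - 1 - j, 0) else (?n d, R - 1 - j, Suc i)), 0)"
      unfolding G_def overlay_dual_simps prv_tait_parallel[OF R M] by simp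
    show "nxt G (Inl (d, i, j), k) = (Inr d, Suc i)" if "k = Suc 0"
      unfolding G_def that using d dp that by (intro overlay_dual_simps(7)) auto
    show "pos G (Inl (d, i, j), k) = (\<not> over D d)"
      by (simp add: G_def)
  qed
  have oppG_r: "opp G (Inr t, k) = (Inr (?n (?n t)), R - k)"
    and nxtG_r0: "nxt G (Inr t, 0) = (Inr (?n (?n (?n (?o t)))), 0)"
    and nxtG_r1: "k < R \<Longrightarrow> nxt G (Inr t, Suc k) = (Inl (?n (?n t), R - 1 - k, R - 1 - k), 1)"
    and posG_r: "pos G (Inr t, k) = over D t"
    if "t \<in> darts D" for t k
    using that by (auto simp: G_def diagonal_def link(4) black(4))
  have oppK: "opp ?K (d, i, j) = (?n (?n d), R - i, R - j)"
    if "d \<in> darts D" "i \<le> R" "j \<le> R" for d i j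
    using that by simp
  have nxtK: "nxt ?K (d, i, j) =
      (if j = 0 then (?n (?n (?n (?o d))), 0, i) else (?n d, Suc R - j, i))"
    if "d \<in> darts D" "i \<le> R" "j \<le> R" for d i j
    using that nxt_tait_parallel[of "Suc R"] by simp
  have step: "opp G x \<in> darts G \<and> nxt G x \<in> darts G \<and> ?F x \<in> darts ?K \<and>
      ?F (opp G x) = opp ?K (?F x) \<and> ?F (nxt G x) = nxt ?K (?F x) \<and> pos ?K (?F x) = pos G x"
    if x: "x \<in> darts G" for x
  proof -
    consider d i j k where "x = (Inl (d, i, j), k)" | t k where "x = (Inr t, k)"
      by (metis obj_sumE prod_cases3 surj_pair)
    then show ?thesis
    proof cases
      case (1 d i j k)
      note x1 = x[unfolded 1]
      note d = x1[unfolded dartsG_l]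
      have idx: "i < R" "j < R" "(odd R \<longrightarrow> face D d \<in> B) = even (i + j)"
        "k = 0 \<or> k = 1 \<and> face D d \<in> B \<and> i = j"
        using d by auto
      \<comment> \<open>As rewrite rules these facts leave goals of pure arithmetic.\<close>
      have near: "d \<in> darts D" "?n d \<in> darts D" "?n (?n d) \<in> darts D" "?n (?n (?n d)) \<in> darts D"
        "?o (?n (?n (?n d))) \<in> darts D" "?o (?o (?n (?n (?n d)))) = ?n (?n (?n d))"
        "?n (?n (?n (?n d))) = d" "?n (?n (?n (?n (?n d)))) = ?n d"
        "face D (?n d) \<in> B \<longleftrightarrow> face D d \<notin> B" "face D (?n (?n d)) \<in> B \<longleftrightarrow> face D d \<in> B"
        "face D (?o (?n (?n (?n d)))) \<in> B \<longleftrightarrow> face D d \<in> B"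
        using d black by simp_all
      have FK: "?F x \<in> darts ?K"
        using d black
        by (cases "face D d \<in> B"; simp add: 1 dartsK F_l del: tait_graph_simps insert_diagonal.simps; presburger)
      have oppG: "opp G x \<in> darts G"
        using d black unfolding 1 oppG_l[OF x1] dartsG_l
        by (cases "face D d \<in> B"; simp; presburger)
      have nxtG: "nxt G x \<in> darts G"
      proof (cases k)
        case 0
        show ?thesis
          using idx unfolding 1 0 nxtG_l0[OF x1[unfolded 0]]
          by (cases "face D d \<in> B"; cases "i = R - 1"; simp add: near dartsG_l; presburger?)
      next
        case (Suc k')
        then have k: "k = Suc 0"
          using d by auto
        then show ?thesis
          using d unfolding 1 nxtG_l1[OF x1 k] by (simp add: dartsG_r)
      qed
      have "?F (opp G x) = opp ?K (?F x)"
        unfolding 1 oppG_l[OF x1]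
      proof (cases "face D d \<in> B")
        case True
        note simps = near True F_l oppK
        consider "j < i" | "i = j" "k = 0" | "i = j" "k = 1" | "i < j" "k = 0"
          using idx(4) by force
        then show "?F (Inl (?n (?n d), R - 1 - i, R - 1 - j),
            (if face D d \<in> B \<and> i = j then 1 else 0) - k) = opp ?K (?F (Inl (d, i, j), k))"
          using idx(1,2)
          by cases (simp_all add: simps Suc_diff_Suc del: tait_graph_simps insert_diagonal.simps, (linarith+)?)
      next
        case False
        note simps = near False F_l oppK
        \<comment> \<open>The colour of the corner excludes the diagonal.\<close>
        have "i + j \<noteq> R - 1"
          using idx(1-3) by (simp add: False; presburger)
        then consider "i + j < R - 1" | "i + j > R - 1"
          by linarith
        then show "?F (Inl (?n (?n d), R - 1 - i, R - 1 - j),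
            (if face D d \<in> B \<and> i = j then 1 else 0) - k) = opp ?K (?F (Inl (d, i, j), k))"
          using idx(1,2)
          by cases (simp_all add: simps Suc_diff_Suc del: tait_graph_simps insert_diagonal.simps, (linarith+)?)
      qed
      moreover have "?F (nxt G x) = nxt ?K (?F x)"
      proof (cases k)
        case 0
        then show ?thesis
          using idx unfolding 1 0 nxtG_l0[OF x1[unfolded 0]]
          by (cases "face D d \<in> B"; cases "i = R - 1"; simp add: near F_l nxtK del: tait_graph_simps insert_diagonal.simps; presburger?)
      next
        case (Suc k')
        then have k: "k = Suc 0"
          using d by auto
        then show ?thesis
          using idx near unfolding 1 nxtG_l1[OF x1 k]
          by (auto simp: F_l nxtK simp del: tait_graph_simps insert_diagonal.simps(2))
      qed
      moreover have "pos ?K (?F x) = pos G x"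
        using d black unfolding 1 F_l by (simp add: posG_l[OF x1])
      ultimately show ?thesis
        using FK oppG nxtG by blast
    next
      case (2 t k)
      note t = x[unfolded 2 dartsG_r]
      have "?F x \<in> darts ?K"
        using t by (simp add: 2 dartsK del: tait_graph_simps)
      moreover have "pos ?K (?F x) = pos G x"
        using t by (simp add: 2 posG_r)
      moreover have "opp G x \<in> darts G \<and> ?F (opp G x) = opp ?K (?F x)"
        using t by (auto simp: 2 oppG_r dartsG_r oppK black simp del: tait_graph_simps)
      moreover have "nxt G x \<in> darts G \<and> ?F (nxt G x) = nxt ?K (?F x)"
      proof (cases k)
        case 0
        then show ?thesis
          using t by (auto simp: 2 nxtG_r0 dartsG_r nxtK black simp del: tait_graph_simps)
      next
        case (Suc m)
        then show ?thesis
          using t by (auto simp: 2 nxtG_r1 dartsG_l F_l nxtK black simp del: tait_graph_simps insert_diagonal.simps(2))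
      qed
      ultimately show ?thesis
        by blast
    qed
  qed
  have inj: "inj_on ?F (darts G)"
  proof (rule inj_onI)
    have n3_eq: "?n (?n (?n d)) = ?n (?n (?n e)) \<longleftrightarrow> d = e" if "d \<in> darts D" "e \<in> darts D" for d e
      using that black by (simp add: n_eq)
    have l: "d = d' \<and> i = i' \<and> j = j' \<and> k = k'"
      if "(Inl (d, i, j), k) \<in> darts G" "(Inl (d', i', j'), k') \<in> darts G"
        "?F (Inl (d, i, j), k) = ?F (Inl (d', i', j'), k')" for d i j k d' i' j' k'
      using that n3_eq[of d d'] unfolding dartsG_l F_l
      by (cases "face D d \<in> B"; auto split: if_splits; presburger)
    have r: "?F (Inl (d, i, j), k) \<noteq> ?F (Inr t, m)"
      if "(Inl (d, i, j), k) \<in> darts G" "(Inr t, m) \<in> darts G" for d i j k t m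
    proof
      assume eq: "?F (Inl (d, i, j), k) = ?F (Inr t, m)"
      have "d \<in> darts D" "face D t \<in> B"
        using that unfolding dartsG_l dartsG_r by auto
      moreover have "t = ?n (?n (?n d))"
        using eq unfolding F_l by simp
      ultimately have "face D d \<notin> B"
        using black by simp
      \<comment> \<open>From a black corner, the renumbering leaves no point on the new diagonal.\<close>
      then have "(if i + j < R - 1 then (j, R - i) else (Suc j, R - 1 - i)) = (m, m)"
        using eq unfolding F_l by simp
      moreover have "i < R" "j < R"
        using that(1) unfolding dartsG_l by auto
      ultimately show False
        by (cases "i + j < R - 1") (simp, linarith)+
    qed
    fix x y
    assume xy: "x \<in> darts G" "y \<in> darts G" "?F x = ?F y"
    have form: "(\<exists>d i j k. z = (Inl (d, i, j), k)) \<or> (\<exists>t k. z = (Inr t, k))"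
      for z :: "(('d \<times> nat \<times> nat) + 'd) \<times> nat"
      by (metis obj_sumE prod_cases3 surj_pair)
    from form[of x] form[of y] consider d i j k d' i' j' k' where "x = (Inl (d, i, j), k)" "y = (Inl (d', i', j'), k')"
      | d i j k t m where "x = (Inl (d, i, j), k)" "y = (Inr t, m)"
      | d i j k t m where "y = (Inl (d, i, j), k)" "x = (Inr t, m)"
      | t k t' k' where "x = (Inr t, k)" "y = (Inr t', k')"
      by (elim disjE exE) blast+
    then show "x = y"
    proof cases
      case (1 d i j k d' i' j' k')
      then show ?thesis
        using l[of d i j k d' i' j' k'] xy by blast
    next
      case (2 d i j k t m)
      then show ?thesis
        using r[of d i j k t m] xy by blast
    next
      case (3 d i j k t m)
      then show ?thesis
        using r[of d i j k t m] xy by metis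
    next
      case (4 t k t' k')
      then show ?thesis
        using xy(3) by simp
    qed
  qed
  have "plane_graph ?K"
    using signed_plane_graph_tait_parallel[of "Suc R"] unfolding signed_plane_graph_def by simp
  then have "connected_map ?K"
    by (rule plane_graphD(5))
  then have "?F ` darts G = darts ?K"
  proof (rule connected_map_closed)
    show "?F ` darts G \<subseteq> darts ?K"
      using step by blast
    fix y
    assume "y \<in> ?F ` darts G"
    then obtain x where x: "x \<in> darts G" "y = ?F x"
      by (elim imageE)
    have "opp ?K y = ?F (opp G x)" "nxt ?K y = ?F (nxt G x)" "opp G x \<in> darts G" "nxt G x \<in> darts G"
      using step[OF x(1)] x(2) by presburger+
    then show "opp ?K y \<in> ?F ` darts G" "nxt ?K y \<in> ?F ` darts G"
      by (metis imageI)+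
  next
    obtain e where "e \<in> darts D"
      using plane(2) by blast
    then obtain d where "d \<in> darts D" "face D d \<in> B"
      using black(2,4)[of e] by metis
    then have "(Inr d, 0) \<in> darts G"
      by (simp add: dartsG_r)
    then show "?F ` darts G \<noteq> {}"
      by blast
  qed
  then show ?thesis
    using step inj by (auto simp: map_iso_def bij_betw_def)
qed

section \<open>The recursion\<close>

lemma map_iso_parallel_1: "map_iso (\<lambda>t. (t, 0, 0)) (tait_graph D B) (tait_parallel 1 D B)"
proof -
  have K: "(d, i, j) \<in> darts (tait_parallel 1 D B) \<longleftrightarrow> d \<in> darts D \<and> face D d \<in> B \<and> i = 0 \<and> j = 0" for d i j
    by (subst darts_tait_parallel) auto
  have "(\<lambda>t. (t, 0, 0)) ` darts (tait_graph D B) = darts (tait_parallel 1 D B)"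
  proof
    show "darts (tait_parallel 1 D B) \<subseteq> (\<lambda>t. (t, 0, 0)) ` darts (tait_graph D B)"
    proof
      fix x
      assume "x \<in> darts (tait_parallel 1 D B)"
      then show "x \<in> (\<lambda>t. (t, 0, 0)) ` darts (tait_graph D B)"
        using K by (cases x) (simp add: image_iff)
    qed
  qed (use K in auto)
  then have "bij_betw (\<lambda>t. (t, 0, 0)) (darts (tait_graph D B)) (darts (tait_parallel 1 D B))"
    by (simp add: bij_betw_def inj_on_def)
  moreover have "nxt (tait_parallel 1 D B) (t, 0, 0) = (nxt (tait_graph D B) t, 0, 0)" if "t \<in> darts D" for t
    using that nxt_tait_parallel[of 1 t 0 0] plane(7) link(4) by simp
  ultimately show ?thesis
    using plane(7,10) link(4) colour by (auto simp: map_iso_def)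
qed

text \<open>
  The induction has to carry the drawing of \<open>T\<close> along, since the next overlay depends on it: the
  isomorphism takes the path of each edge of \<open>T\<close> to the diagonal of a grid.
\<close>

lemma tait_rec_parallel:
  assumes "r \<ge> 1" "tait_rec (tait_graph D B) r = (M, p)"
  obtains f where "map_iso f M (tait_parallel r D B)"
    and "\<And>t. t \<in> darts (tait_graph D B) \<Longrightarrow> set (p t) \<subseteq> darts M \<and> map f (p t) = diagonal r t"
  using assms
proof (induction r arbitrary: M p thesis rule: nat_induct_at_least)
  case base
  let ?T = "tait_graph D B"
  have Mp: "M = relabel Dart ?T" "p = (\<lambda>t. [Dart t])"
    using base.prems(2) by simp_all
  have T: "plane_graph ?T"
    using signed_plane_graph_tait[OF D B] by (simp add: signed_plane_graph_def)
  define g where "g = inv_into (darts ?T) Dart"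
  have "map_iso Dart ?T M"
    unfolding Mp using plane_graphD(7,10)[OF T] by (intro map_iso_relabel) (auto simp: inj_on_def)
  then have "map_iso g M ?T"
    unfolding g_def by (rule map_iso_sym)
  then have "map_iso ((\<lambda>t. (t, 0, 0)) \<circ> g) M (tait_parallel 1 D B)"
    using map_iso_parallel_1 by (rule map_iso_comp)
  moreover have "g (Dart t) = t" if "t \<in> darts ?T" for t
    unfolding g_def using that by (intro inv_into_f_f) (auto simp: inj_on_def)
  moreover have "Dart ` darts ?T = darts M"
    by (simp add: Mp relabel_def Let_def)
  ultimately show ?case
    by (intro base.prems(1)) (auto simp: Mp(2) diagonal_def)
next
  case (Suc r)
  let ?T = "tait_graph D B" and ?K = "\<lambda>r. tait_parallel r D B"
  obtain M' p' where M': "tait_rec ?T r = (M', p')"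
    by (cases "tait_rec ?T r")
  obtain f where f: "map_iso f M' (?K r)"
    and p': "\<And>t. t \<in> darts ?T \<Longrightarrow> set (p' t) \<subseteq> darts M' \<and> map f (p' t) = diagonal r t"
    using Suc.IH M' by blast
  have r: "Suc (r - 1) = r"
    using Suc.hyps by simp
  define G where "G = overlay_dual M' ?T p'"
  have Mp: "M = relabel (case_prod Piece) G" "p = (\<lambda>t. map (Piece (Inr t)) [0..<Suc (length (p' t))])"
    using Suc.prems(2) M' tait_rec.simps(2)[of ?T "r - 1"] unfolding r G_def by simp_all
  let ?H = "overlay_dual (?K r) ?T (diagonal r)"
  note F = map_iso_insert_diagonal[OF Suc.hyps]
  define h where "h = (\<lambda>(s, i). (map_sum f id s, i) :: (('d \<times> nat \<times> nat) + 'd) \<times> nat)"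
  have K: "plane_graph (?K r)" "plane_graph M'"
    using signed_plane_graph_tait_parallel[OF Suc.hyps] signed_plane_graph_iso[OF map_iso_sym[OF f]]
    by (auto simp: signed_plane_graph_def)
  have h: "map_iso h G ?H"
    unfolding G_def h_def
  proof (rule map_iso_overlay_dual[OF f K(2,1)])
    show "opp ?H x \<in> darts ?H" "nxt ?H x \<in> darts ?H" if "x \<in> darts ?H" for x
      using F that by (auto simp: map_iso_def)
  qed (use p' in auto)
  define g where "g = inv_into (darts G) (case_prod Piece)"
  have inj: "inj_on (case_prod Piece) (darts G)"
    by (auto simp: inj_on_def)
  have "map_iso (case_prod Piece) G M"
    unfolding Mp using h inj by (intro map_iso_relabel) (auto simp: map_iso_def)
  then have "map_iso g M G"
    unfolding g_def by (rule map_iso_sym)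
  then have "map_iso (insert_diagonal r D B \<circ> (h \<circ> g)) M (?K (Suc r))"
    using h F by (blast intro: map_iso_comp)
  moreover have "set (p t) \<subseteq> darts M \<and> map (insert_diagonal r D B \<circ> (h \<circ> g)) (p t) = diagonal (Suc r) t"
    if t: "t \<in> darts ?T" for t
  proof -
    have "length (map f (p' t)) = r"
      using p'[OF t] by (simp add: diagonal_def)
    then have len: "length (p' t) = r"
      by simp
    have G: "(Inr t, k) \<in> darts G" if "k < Suc r" for k
      using t that len by (simp add: G_def)
    have "Piece (Inr t) k \<in> darts M" if "k < Suc r" for k
      using G[OF that] by (force simp: Mp(1) relabel_def Let_def)
    moreover have "g (Piece (Inr t) k) = (Inr t, k)" if "k < Suc r" for k
      using inv_into_f_f[OF inj G[OF that]] by (simp add: g_def)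
    ultimately show ?thesis
      by (auto simp: Mp(2) len diagonal_def h_def simp del: upt_Suc)
  qed
  ultimately show ?case
    by (rule Suc.prems(1))
qed

end

theorem theorem5:
  fixes D :: "'a diagram" and B :: "'a set set" and r :: nat
  assumes "link_diagram D"
    and "checkerboard D B"
    and "r \<ge> 1"
  shows "link_diagram (parallel r D)
    \<and> signed_plane_graph (tait_iter r (tait_graph D B))
    \<and> (\<exists>B'. checkerboard (parallel r D) B'
         \<and> tait_iter r (tait_graph D B) \<simeq> tait_iter 1 (tait_graph (parallel r D) B')
         \<and> tait_iter 1 (tait_graph (parallel r D) B') \<simeq> tait_graph (parallel r D) B')"
proof -
  let ?K = "tait_parallel r D B" and ?T = "tait_graph D B"
  obtain M p where M: "tait_rec ?T r = (M, p)"
    by (cases "tait_rec ?T r")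
  obtain f where "map_iso f M ?K"
    using tait_rec_parallel[OF assms M] by metis
  then have f: "map_iso f (tait_iter r ?T) ?K"
    by (simp add: tait_iter_def M)
  have K: "signed_plane_graph ?K"
    by (rule signed_plane_graph_tait_parallel[OF assms])
  have 1: "map_iso Dart ?K (tait_iter 1 ?K)"
    using K plane_graphD(7,10)[of ?K] unfolding tait_iter_def signed_plane_graph_def
    by (auto simp: inj_on_def simp del: tait_graph_simps intro!: map_iso_relabel)
  show ?thesis
    using link_diagram_parallel[OF assms(1,3)] signed_plane_graph_iso[OF map_iso_sym[OF f] K]
      parallel_colouring(1)[OF assms] map_iso_plane_eq[OF map_iso_comp[OF f 1]]
      map_iso_plane_eq[OF map_iso_sym[OF 1]]
    by blast
qed

end
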